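(* There is a deterministic distributed algorithm in the broadcast congested clique model that computes a maximal independent set of the input graph $G$ within $O(\log \Delta \log n)$ rounds, where $n$ is the number of nodes and $\Delta$ the maximum degree of $G$.
   Context: The input is an undirected graph $G=(V,E)$ with $n=|V|$ nodes, each node knowing its own unique $O(\log n)$-bit identifier and its incident edges. In the broadcast congested clique model, computation proceeds in synchronous rounds; in each round every node sends one and the same $O(\log n)$-bit message to all other $n-1$ nodes (communication is all-to-all, independent of $G$), and local computation is free. A maximal independent set is a set $I\subseteq V$ with no two nodes of $I$ adjacent in $G$ such that every node of $V\setminus I$ has a neighbor in $I$; at the end every node must know whether it belongs to $I$. *)

theory Defs
  imports Complex_Main
begin

definition simple_graph :: "nat \<Rightarrow> (nat \<Rightarrow> nat \<Rightarrow> bool) \<Rightarrow> bool" where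
  "simple_graph n E \<longleftrightarrow>
     (\<forall>u v. E u v \<longrightarrow> u < n \<and> v < n) \<and> (\<forall>u v. E u v \<longrightarrow> E v u) \<and> (\<forall>v. \<not> E v v)"

definition degree :: "nat \<Rightarrow> (nat \<Rightarrow> nat \<Rightarrow> bool) \<Rightarrow> nat \<Rightarrow> nat" where
  "degree n E v = card {u. u < n \<and> E v u}"

definition max_degree :: "nat \<Rightarrow> (nat \<Rightarrow> nat \<Rightarrow> bool) \<Rightarrow> nat" where
  "max_degree n E = Max ({degree n E v | v. v < n} \<union> {0})"

definition independent_set :: "nat \<Rightarrow> (nat \<Rightarrow> nat \<Rightarrow> bool) \<Rightarrow> nat set \<Rightarrow> bool" where
  "independent_set n E I \<longleftrightarrow> I \<subseteq> {..<n} \<and> (\<forall>u\<in>I. \<forall>v\<in>I. \<not> E u v)"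

definition maximal_independent_set :: "nat \<Rightarrow> (nat \<Rightarrow> nat \<Rightarrow> bool) \<Rightarrow> nat set \<Rightarrow> bool" where
  "maximal_independent_set n E I \<longleftrightarrow>
     independent_set n E I \<and> (\<forall>v<n. v \<notin> I \<longrightarrow> (\<exists>u\<in>I. E v u))"

text \<open>The local state of a node is its complete view: the number of nodes n, its own
identifier, the identifiers of its neighbours, and the list of everything it has received
so far (round r entry maps each identifier of a node to the message that node broadcast
in round r; None for identifiers not in use). Since local computation is free and
deterministic, an algorithm is given by a message function and an output function on
views; the message must be a number below (n+2)^c, i.e. O(log n) bits.\<close>

type_synonym view = "nat \<times> nat \<times> nat set \<times> (nat \<Rightarrow> nat option) list"

primrec views :: "(view \<Rightarrow> nat) \<Rightarrow> nat \<Rightarrow> (nat \<Rightarrow> nat \<Rightarrow> bool) \<Rightarrow> (nat \<Rightarrow> nat)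
                  \<Rightarrow> nat \<Rightarrow> nat \<Rightarrow> view" where
  "views msg n E idf 0 = (\<lambda>v. (n, idf v, {idf u | u. u < n \<and> E v u}, []))"
| "views msg n E idf (Suc t) =
     (\<lambda>v. let V = views msg n E idf t;
              rcv = (\<lambda>i. if i \<in> idf ` {..<n}
                         then Some (msg (V (the_inv_into {..<n} idf i))) else None);
              (n', i', N', h) = V v
          in (n', i', N', h @ [rcv]))"

definition computes_MIS_within ::
  "(view \<Rightarrow> nat) \<Rightarrow> (view \<Rightarrow> bool option) \<Rightarrow> nat \<Rightarrow> nat
   \<Rightarrow> nat \<Rightarrow> (nat \<Rightarrow> nat \<Rightarrow> bool) \<Rightarrow> (nat \<Rightarrow> nat) \<Rightarrow> bool" where
  "computes_MIS_within msg out c T n E idf \<longleftrightarrow>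
     (\<forall>t<T. \<forall>v<n. msg (views msg n E idf t v) < (n + 2) ^ c) \<and>
     (\<forall>v<n. out (views msg n E idf T v) \<noteq> None \<and>
            (\<forall>t\<ge>T. out (views msg n E idf t v) = out (views msg n E idf T v))) \<and>
     maximal_independent_set n E {v. v < n \<and> out (views msg n E idf T v) = Some True}"

end

theory Submission
  imports Defs "HOL-Library.FuncSet"
begin

text \<open>
  If \<open>2 ^ \<Delta> \<le> n + 2\<close>, all neighbour lists can be broadcast in \<open>\<Delta>\<close> rounds. Otherwise
  \<open>log n < \<Delta>\<close>, and we derandomise Luby's algorithm with a seed of \<open>O(log \<Delta>)\<close> bits: node \<open>v\<close> of
  residual degree \<open>d v\<close> is marked with probability about \<open>1 / (32 d v)\<close> and joins the independent set
  if no neighbour of at least its priority is marked. The analysis of a phase only uses a lower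
  bound for the marking probabilities and an upper bound for pairs. Since \<open>log n < \<Delta>\<close>, a greedy
  choice of hash functions provides such markings with only polynomially many seeds in \<open>\<Delta>\<close>.
  A quadratic estimator of the number of removed arcs is a sum of terms that are known to single
  nodes, so the seed can be fixed with two broadcasts per bit. A phase takes \<open>O(log \<Delta>)\<close> rounds and
  removes a constant fraction of the arcs, hence \<open>O(log n)\<close> phases suffice.
\<close>

section \<open>Almost pairwise independent markings\<close>

text \<open>Exact pairwise independence of the marks needs at least as many seeds as nodes, so
  fixing the seed bit by bit would cost order \<open>log n\<close> rounds per phase. Granting pairs
  a factor 4 lets the seed length depend on the number \<open>N\<close> of identifiers only through
  \<open>log log N\<close>, which is of order \<open>log \<Delta>\<close> once
  \<open>log n < \<Delta>\<close>. The scale 32 in the marking probabilities pays for this factor.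
  Relative to the event that a candidate dominator is marked, a second marked candidate costs at
  most \<open>4 * (1 / 16)\<close> and a marked blocker at most \<open>4 * (1 / 32)\<close>, so at
  least half of the expected gain survives.\<close>

lemma card_div_mod:
  fixes A B :: nat
  assumes "B > 0"
  shows "card {c. c < A * B \<and> P (c div B) (c mod B)} = (\<Sum>a<A. card {c. c < B \<and> P a c})"
proof -
  have "bij_betw (\<lambda>(a, c). a * B + c) (SIGMA a:{..<A}. {c. c < B \<and> P a c})
          {c. c < A * B \<and> P (c div B) (c mod B)}"
    (is "bij_betw ?f ?S ?T")
  proof (rule bij_betwI[where g = "\<lambda>c. (c div B, c mod B)"])
    show "?f \<in> ?S \<rightarrow> ?T"
    proof (clarsimp simp: assms)
      fix a c assume "a < A" "c < B"
      then have "a * B + c < (a + 1) * B" by simp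
      also have "\<dots> \<le> A * B" using \<open>a < A\<close> by (intro mult_le_mono1) simp
      finally show "a * B + c < A * B" .
    qed
  qed (use assms in \<open>auto simp: less_mult_imp_div_less\<close>)
  then have "card (SIGMA a:{..<A}. {c. c < B \<and> P a c}) = card ?T"
    by (rule bij_betw_same_card)
  then show ?thesis by simp
qed

lemma card_cong_class:
  fixes a :: nat
  assumes "j \<le> m"
  shows "card {c. c < 2 ^ m \<and> c mod 2 ^ j = a mod 2 ^ j} = 2 ^ (m - j)"
proof -
  have "card {c. c < 2 ^ (m - j) * 2 ^ j \<and> c mod 2 ^ j = a mod 2 ^ j}
     = (\<Sum>i<(2::nat) ^ (m - j). card {c. c < 2 ^ j \<and> c = a mod 2 ^ j})"
    by (rule card_div_mod[where P = "\<lambda>_ c. c = a mod 2 ^ j"]) simp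
  also have "{c. c < 2 ^ j \<and> c = a mod 2 ^ j} = {a mod 2 ^ j}" by auto
  finally show ?thesis using assms by (simp flip: power_add)
qed

section \<open>Collisions of random words\<close>

abbreviation words :: "nat \<Rightarrow> nat \<Rightarrow> (nat \<Rightarrow> nat) set" where
  "words S q \<equiv> PiE {..<S} (\<lambda>_. {..<q})"

definition agree :: "nat \<Rightarrow> nat \<Rightarrow> (nat \<Rightarrow> nat) \<Rightarrow> (nat \<Rightarrow> nat) \<Rightarrow> nat" where
  "agree S j w w' = card {s. s < S \<and> w s mod 2 ^ j = w' s mod 2 ^ j}"

text \<open>Exponential moment, in base 2, of the number of collisions with a fixed word. Letters
  are independent, so the sum factors over the positions; at each position
  \<open>2 ^ (m - j)\<close> of the \<open>2 ^ m\<close> letters collide and weigh 2 instead of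
  1.\<close>

lemma agree_exp_moment:
  assumes "j \<le> m"
  shows "(\<Sum>w\<in>words S (2 ^ m). 2 ^ agree S j w w') = ((2 ^ m + 2 ^ (m - j)) ^ S :: nat)"
proof -
  define g :: "nat \<Rightarrow> nat \<Rightarrow> nat"
    where "g s c = (if c mod 2 ^ j = w' s mod 2 ^ j then 2 else 1)" for s c
  have 1: "2 ^ agree S j w w' = (\<Prod>s<S. g s (w s))" for w
  proof -
    have "(\<Prod>s<S. g s (w s)) = (\<Prod>s\<in>{s\<in>{..<S}. w s mod 2 ^ j = w' s mod 2 ^ j}. 2)"
      unfolding g_def by (subst prod.inter_filter) auto
    then show ?thesis by (simp add: agree_def)
  qed
  have 2: "(\<Sum>c<2 ^ m. g s c) = 2 ^ m + 2 ^ (m - j)" for s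
  proof -
    have "(\<Sum>c<2 ^ m. g s c) = (\<Sum>c<2 ^ m. 1 + (if c mod 2 ^ j = w' s mod 2 ^ j then 1 else 0))"
      by (intro sum.cong) (auto simp: g_def)
    also have "\<dots> = 2 ^ m + (\<Sum>c\<in>{c \<in> {..<2 ^ m}. c mod 2 ^ j = w' s mod 2 ^ j}. 1)"
      unfolding sum.distrib by (subst sum.inter_filter) simp_all
    finally show ?thesis using card_cong_class[OF assms, of "w' s"] by simp
  qed
  have "(\<Sum>w\<in>words S (2 ^ m). 2 ^ agree S j w w') = (\<Sum>w\<in>words S (2 ^ m). \<Prod>s<S. g s (w s))"
    by (simp add: 1)
  also have "\<dots> = (\<Prod>s<S. \<Sum>c<2 ^ m. g s c)"
    by (rule prod_sum_PiE[symmetric]) auto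
  finally show ?thesis by (simp add: 2)
qed

text \<open>A Chernoff bound: at \<open>2 ^ j * q\<close> positions a random word collides
  \<open>q\<close> times on average. Markov's inequality for the moment in base 2 bounds the
  fraction of words with more than \<open>4 * q\<close> collisions by
  \<open>(1 + 1 / 2 ^ j) ^ (2 ^ j * q) / 16 ^ q\<close>, and
  \<open>(1 + 1 / x) ^ x \<le> exp 1 \<le> 4\<close>.\<close>

lemma card_agree_large:
  assumes "j \<le> m"
  shows "card {w \<in> words (2 ^ j * q) (2 ^ m). 4 * q < agree (2 ^ j * q) j w w'} * 4 ^ q
           \<le> (2 ^ m) ^ (2 ^ j * q)"
proof -
  let ?S = "2 ^ j * q"
  let ?B = "{w \<in> words ?S (2 ^ m). 4 * q < agree ?S j w w'}"
  have fin: "finite (words ?S (2 ^ m))" by (intro finite_PiE) auto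
  have "card ?B * 2 ^ (4 * q) = (\<Sum>w\<in>?B. 2 ^ (4 * q))" by simp
  also have "\<dots> \<le> (\<Sum>w\<in>?B. 2 ^ agree ?S j w w')"
    by (intro sum_mono power_increasing) auto
  also have "\<dots> \<le> (\<Sum>w\<in>words ?S (2 ^ m). 2 ^ agree ?S j w w')"
    by (intro sum_mono2 fin) auto
  also have "\<dots> = (2 ^ m + 2 ^ (m - j)) ^ ?S" by (rule agree_exp_moment[OF assms])
  finally have "real (card ?B * 2 ^ (4 * q)) \<le> real ((2 ^ m + 2 ^ (m - j)) ^ ?S)"
    by (rule of_nat_mono)
  then have *: "real (card ?B) * 2 ^ (4 * q) \<le> (2 ^ m + 2 ^ (m - j)) ^ ?S"
    by simp
  have "(1 + 1 / 2 ^ j :: real) ^ (2 ^ j) \<le> exp (1 / 2 ^ j) ^ (2 ^ j)"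
    by (intro power_mono) (auto simp: exp_ge_add_one_self )
  also have "\<dots> = exp 1" by (simp flip: exp_of_nat_mult)
  also have "\<dots> \<le> 4" using exp_le by linarith
  finally have e: "(1 + 1 / 2 ^ j :: real) ^ (2 ^ j) \<le> 4" .
  have "(2 ^ m + 2 ^ (m - j) :: real) = 2 ^ m * (1 + 1 / 2 ^ j)"
    using assms by (simp add: power_diff field_simps)
  then have "(2 ^ m + 2 ^ (m - j) :: real) ^ ?S = (2 ^ m) ^ ?S * ((1 + 1 / 2 ^ j) ^ (2 ^ j)) ^ q"
    by (simp add: power_mult_distrib power_mult)
  also have "\<dots> \<le> (2 ^ m) ^ ?S * 4 ^ q"
    by (intro mult_left_mono power_mono e) auto
  finally have "real (card ?B) * 2 ^ (4 * q) \<le> (2 ^ m) ^ ?S * 4 ^ q" using * by linarith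
  moreover have "(2 :: real) ^ (4 * q) = 4 ^ q * 4 ^ q"
    unfolding power_mult power_mult_distrib[symmetric] by simp
  ultimately have "(real (card ?B) * 4 ^ q) * 4 ^ q \<le> (2 ^ m) ^ ?S * 4 ^ q" by (simp only: mult.assoc)
  then have "real (card ?B * 4 ^ q) \<le> real ((2 ^ m) ^ ?S)" by simp
  then show ?thesis by (simp only: of_nat_le_iff)
qed

text \<open>Greedy choice in the style of the Gilbert--Varshamov bound: the words that agree too often
  with one of the words chosen so far do not exhaust all words.\<close>

lemma hash_family_exists:
  assumes "N * (m + 1) < 4 ^ (2 ^ r)"
  shows "\<exists>h. \<forall>x<N. \<forall>y<N. x \<noteq> y \<longrightarrow>
           (\<forall>j\<le>m. agree (2 ^ (m + r)) j (h x) (h y) \<le> 4 * 2 ^ (m + r - j))"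
  using assms
proof (induction N)
  case 0
  then show ?case by simp
next
  case (Suc N)
  let ?S = "2 ^ (m + r) :: nat"
  let ?W = "words ?S (2 ^ m)"
  from Suc obtain h where h: "\<And>x y j. x < N \<Longrightarrow> y < N \<Longrightarrow> x \<noteq> y \<Longrightarrow> j \<le> m \<Longrightarrow>
      agree ?S j (h x) (h y) \<le> 4 * 2 ^ (m + r - j)"
    by auto
  define B where "B x j = {w \<in> ?W. 4 * 2 ^ (m + r - j) < agree ?S j w (h x)}" for x j
  have finW: "finite ?W" by (intro finite_PiE) auto
  have cW: "card ?W = (2 ^ m) ^ ?S" by (simp add: card_PiE)
  have B: "card (B x j) * 4 ^ (2 ^ r) \<le> card ?W" if "j \<le> m" for x j
  proof -
    have S: "?S = 2 ^ j * 2 ^ (m + r - j)" using that by (simp flip: power_add)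
    have "card (B x j) * 4 ^ (2 ^ (m + r - j)) \<le> card ?W"
      using card_agree_large[OF that, of "2 ^ (m + r - j)" "h x"]
      unfolding B_def cW S[symmetric] .
    \<comment> \<open>The finest level \<open>j = m\<close> is the critical one; the word length
      \<open>2 ^ (m + r)\<close> still gives it \<open>2 ^ r\<close> expected collisions. This
      yields one failure bound for all \<open>N * (m + 1)\<close> bad sets of the union
      bound.\<close>
    moreover have "card (B x j) * 4 ^ (2 ^ r) \<le> card (B x j) * 4 ^ (2 ^ (m + r - j))"
      using that by (intro mult_le_mono2 power_increasing) auto
    ultimately show ?thesis by linarith
  qed
  have "card (\<Union>(x, j)\<in>{..<N} \<times> {..m}. B x j) * 4 ^ (2 ^ r)
      \<le> (\<Sum>(x, j)\<in>{..<N} \<times> {..m}. card (B x j)) * 4 ^ (2 ^ r)"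
    using card_UN_le[of "{..<N} \<times> {..m}" "\<lambda>(x, j). B x j"]
    by (intro mult_le_mono1) (simp add: case_prod_unfold)
  also have "\<dots> \<le> (\<Sum>(x, j)\<in>{..<N} \<times> {..m}. card ?W)"
    unfolding sum_distrib_right by (intro sum_mono) (use B in auto)
  also have "\<dots> = N * (m + 1) * card ?W" by (simp add: mult.assoc)
  also have "\<dots> < 4 ^ (2 ^ r) * card ?W"
    using Suc.prems cW by (intro mult_strict_right_mono) auto
  finally have "card (\<Union>(x, j)\<in>{..<N} \<times> {..m}. B x j) < card ?W" by simp
  then have "\<not> ?W \<subseteq> (\<Union>(x, j)\<in>{..<N} \<times> {..m}. B x j)"
    using card_mono[of "\<Union>(x, j)\<in>{..<N} \<times> {..m}. B x j" ?W] finW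
    by (force simp: B_def not_less)
  then obtain w where w: "w \<in> ?W" "\<And>x j. x < N \<Longrightarrow> j \<le> m \<Longrightarrow> w \<notin> B x j" by fast
  have w': "agree ?S j w (h x) \<le> 4 * 2 ^ (m + r - j)" if "x < N" "j \<le> m" for x j
    using w(1) w(2)[OF that] by (simp add: B_def)
  have sym: "agree ?S j u v = agree ?S j v u" for j u v
    by (simp add: agree_def eq_commute)
  show ?case
    by (rule exI[of _ "h(N := w)"]) (use h w' sym in \<open>auto simp: less_Suc_eq\<close>)
qed

text \<open>Seed \<open>s\<close> marks identifier \<open>x\<close> at level \<open>j\<close>, which happens with probability exactly \<open>2 ^ - j\<close>;
  two marks are independent up to a factor 4. A seed consists of a position of the words and a
  residue. Of two congruences modulo powers of two the finer one fixes the residue, and then the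
  coarser one is a collision of the two words at that position.\<close>

definition marking :: "nat \<Rightarrow> nat \<Rightarrow> nat \<Rightarrow> (nat \<Rightarrow> nat \<Rightarrow> nat \<Rightarrow> bool) \<Rightarrow> bool" where
  "marking N m L mk \<longleftrightarrow>
    (\<forall>x. \<forall>j\<le>m. card {s. s < 2 ^ L \<and> mk s x j} * 2 ^ j = 2 ^ L) \<and>
    (\<forall>x<N. \<forall>y<N. x \<noteq> y \<longrightarrow> (\<forall>i\<le>m. \<forall>j\<le>m.
       card {s. s < 2 ^ L \<and> mk s x i \<and> mk s y j} * 2 ^ (i + j) \<le> 4 * 2 ^ L))"

lemma marking_exists:
  assumes "N * (m + 1) < 4 ^ (2 ^ r)"
  shows "\<exists>mk. marking N m (2 * m + r) mk"
proof -
  obtain h where h: "\<And>x y j. x < N \<Longrightarrow> y < N \<Longrightarrow> x \<noteq> y \<Longrightarrow> j \<le> m \<Longrightarrow>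
      agree (2 ^ (m + r)) j (h x) (h y) \<le> 4 * 2 ^ (m + r - j)"
    using hash_family_exists[OF assms] by blast
  \<comment> \<open>The quotient is the position and the remainder the residue, hence
    \<open>m + r\<close> plus \<open>m\<close> bits of seed. For a fixed quotient the remainder is
    uniform, so the frequency of a single mark is exact whatever \<open>h\<close> is.\<close>
  define mk where "mk s x j \<longleftrightarrow> s mod 2 ^ m mod 2 ^ j = h x (s div 2 ^ m) mod 2 ^ j" for s x j
  let ?L = "2 * m + r"
  have L: "(2::nat) ^ ?L = 2 ^ (m + r) * 2 ^ m" by (simp flip: power_add)
  have one: "card {s. s < 2 ^ ?L \<and> mk s x j} * 2 ^ j = 2 ^ ?L" if "j \<le> m" for x j
  proof -
    have "card {s. s < 2 ^ ?L \<and> mk s x j} = (\<Sum>a<(2::nat) ^ (m + r). 2 ^ (m - j))"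
      unfolding L mk_def
      by (subst card_div_mod[where P = "\<lambda>a c. c mod 2 ^ j = h x a mod 2 ^ j"])
        (simp_all add: card_cong_class that)
    then show ?thesis using that by (simp add: L flip: power_add)
  qed
  have two: "card {s. s < 2 ^ ?L \<and> mk s x i \<and> mk s y j} * 2 ^ (i + j) \<le> 4 * 2 ^ ?L"
    if "x < N" "y < N" "x \<noteq> y" "i \<le> j" "j \<le> m" for x y i j
  proof -
    have "card {s. s < 2 ^ ?L \<and> mk s x i \<and> mk s y j}
       = (\<Sum>a<2 ^ (m + r). card {c. c < 2 ^ m \<and> c mod 2 ^ i = h x a mod 2 ^ i \<and> c mod 2 ^ j = h y a mod 2 ^ j})"
      unfolding L mk_def
      by (subst card_div_mod[where P = "\<lambda>a c. c mod 2 ^ i = h x a mod 2 ^ i \<and> c mod 2 ^ j = h y a mod 2 ^ j"])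
        simp_all
    also have "\<dots> \<le> (\<Sum>a<2 ^ (m + r). if h x a mod 2 ^ i = h y a mod 2 ^ i then 2 ^ (m - j) else 0)"
    proof (intro sum_mono)
      fix a
      let ?C = "{c. c < 2 ^ m \<and> c mod 2 ^ i = h x a mod 2 ^ i \<and> c mod 2 ^ j = h y a mod 2 ^ j}"
      have d: "(2::nat) ^ i dvd 2 ^ j" using that by (simp add: le_imp_power_dvd)
      show "card ?C \<le> (if h x a mod 2 ^ i = h y a mod 2 ^ i then 2 ^ (m - j) else 0)"
      proof (cases "h x a mod 2 ^ i = h y a mod 2 ^ i")
        case True
        have "card ?C \<le> card {c. c < 2 ^ m \<and> c mod 2 ^ j = h y a mod 2 ^ j}"
          by (intro card_mono) auto
        then show ?thesis using True that by (simp add: card_cong_class)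
      next
        case False
        have "?C = {}"
        proof (rule ccontr)
          assume "?C \<noteq> {}"
          then obtain c where "c mod 2 ^ i = h x a mod 2 ^ i" "c mod 2 ^ j = h y a mod 2 ^ j" by auto
          then show False using False d by (metis mod_mod_cancel)
        qed
        then have "card ?C = 0" by (simp only: card.empty)
        then show ?thesis by linarith
      qed
    qed
    also have "\<dots> = agree (2 ^ (m + r)) i (h x) (h y) * 2 ^ (m - j)"
      by (simp add: agree_def flip: sum.inter_filter)
    also have "\<dots> \<le> 4 * 2 ^ (m + r - i) * 2 ^ (m - j)"
      using h that by (intro mult_le_mono1) auto
    finally have "card {s. s < 2 ^ ?L \<and> mk s x i \<and> mk s y j} * 2 ^ (i + j)
        \<le> 4 * 2 ^ (m + r - i) * 2 ^ (m - j) * 2 ^ (i + j)"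
      by (rule mult_le_mono1)
    also have "\<dots> = 4 * 2 ^ ?L" using that by (simp flip: power_add)
    finally show ?thesis .
  qed
  have "card {s. s < 2 ^ ?L \<and> mk s x i \<and> mk s y j} * 2 ^ (i + j) \<le> 4 * 2 ^ ?L"
    if "x < N" "y < N" "x \<noteq> y" "i \<le> m" "j \<le> m" for x y i j
    using two[of x y i j] two[of y x j i] that
    by (cases "i \<le> j") (auto simp: add.commute conj_commute)
  then show ?thesis using one unfolding marking_def by blast
qed

section \<open>One derandomised phase\<close>

locale nbr_graph =
  fixes X :: "nat set" and N :: "nat \<Rightarrow> nat set"
  assumes finite_X: "finite X"
    and N_subset: "x \<in> X \<Longrightarrow> N x \<subseteq> X"
    and N_sym: "x \<in> X \<Longrightarrow> y \<in> N x \<Longrightarrow> x \<in> N y"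
    and N_irrefl: "x \<in> X \<Longrightarrow> x \<notin> N x"

text \<open>\<open>2 ^ - prio d\<close> is the marking probability, a power of two so that a
  congruence modulo \<open>2 ^ j\<close> realises it exactly. Since \<open>prio 0 = 0\<close>, a
  node of residual degree 0 is always marked and, having no blockers, wins at once.\<close>

definition prio :: "nat \<Rightarrow> nat" where
  "prio d = (LEAST j. 32 * d \<le> 2 ^ j)"

lemma Least_power_ge:
  fixes a :: nat
  assumes "a > 0"
  shows "a \<le> 2 ^ (LEAST j. a \<le> 2 ^ j)" and "2 ^ (LEAST j. a \<le> 2 ^ j) < 2 * a"
proof -
  have "a \<le> 2 ^ a" using less_exp[of a] by linarith
  then show *: "a \<le> 2 ^ (LEAST j. a \<le> 2 ^ j)" by (rule LeastI)
  show "2 ^ (LEAST j. a \<le> 2 ^ j) < 2 * a"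
  proof (cases "LEAST j. a \<le> 2 ^ j")
    case 0
    then show ?thesis using assms by simp
  next
    case (Suc i)
    then have "\<not> a \<le> 2 ^ i" using not_less_Least[of i "\<lambda>j. a \<le> 2 ^ j"] by simp
    then show ?thesis using Suc by simp
  qed
qed

lemma prio_ge: "32 * d \<le> 2 ^ prio d"
  using Least_power_ge(1)[of "32 * d"] by (cases "d = 0") (auto simp: prio_def)

lemma prio_less: "0 < d \<Longrightarrow> 2 ^ prio d < 64 * d"
  using Least_power_ge(2)[of "32 * d"] by (auto simp: prio_def)

lemma prio_mono: "d \<le> d' \<Longrightarrow> prio d \<le> prio d'"
  unfolding prio_def[of d] by (rule Least_le) (use prio_ge[of d'] in linarith)

text \<open>The nodes in \<open>low\<close> are the dominators of \<open>x\<close> that the analysis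
  counts, those in \<open>high\<close> can block \<open>x\<close>. Ties lie in both sets, so
  adjacent marked nodes of equal priority block each other.\<close>

definition low :: "nat set \<Rightarrow> (nat \<Rightarrow> nat) \<Rightarrow> nat \<Rightarrow> nat set \<Rightarrow> nat set" where
  "low U d x A = {v \<in> A \<inter> U. prio (d v) \<le> prio (d x)}"

definition high :: "nat set \<Rightarrow> (nat \<Rightarrow> nat) \<Rightarrow> nat \<Rightarrow> nat set \<Rightarrow> nat set" where
  "high U d x A = {v \<in> A \<inter> U. prio (d x) \<le> prio (d v)}"

definition prob :: "(nat \<Rightarrow> nat) \<Rightarrow> nat \<Rightarrow> real" where
  "prob d x = 1 / 2 ^ prio (d x)"

text \<open>The total marking probability of \<open>low\<close> can be large. The cutoff keeps a prefix in
  identifier order, so that a single broadcast number tells every neighbour whether it was kept.\<close>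

definition cutoff :: "nat set \<Rightarrow> (nat \<Rightarrow> nat) \<Rightarrow> nat \<Rightarrow> nat set \<Rightarrow> nat" where
  "cutoff U d x A =
     (LEAST t. card (low U d x A) * prob d x \<le> (\<Sum>v\<in>low U d x A \<inter> {..<t}. prob d v))"

definition winner :: "nat set \<Rightarrow> (nat \<Rightarrow> nat) \<Rightarrow> nat set \<Rightarrow> nat \<Rightarrow> nat set \<Rightarrow> bool" where
  "winner U d M x A \<longleftrightarrow> x \<in> M \<and> high U d x A \<inter> M = {}"

text \<open>Bonferroni lower bound for the arcs removed at dominated nodes. The last term charges the
  blocking of \<open>x\<close> to \<open>x\<close> itself and not to the neighbours that lose their dominator, because a
  node sees its own neighbourhood only.\<close>

definition gain :: "nat set \<Rightarrow> (nat \<Rightarrow> nat) \<Rightarrow> (nat \<Rightarrow> nat) \<Rightarrow> nat set \<Rightarrow> nat \<Rightarrow> nat set \<Rightarrow> int" where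
  "gain U d t M x A =
     (let y = int (card (low U d x A \<inter> {..<t x} \<inter> M)) in int (d x) * (y - y * (y - 1)))
     - (if x \<in> M then int (card (high U d x A \<inter> M)) * (\<Sum>w | w \<in> high U d x A \<and> x < t w. int (d w))
        else 0)"

text \<open>A least prefix overshoots the threshold by at most its last term. The bound
  \<open>t \<le> b\<close> later makes the cutoff fit into a message.\<close>

lemma Least_prefix_sum:
  fixes p :: "nat \<Rightarrow> real"
  assumes "finite A" "A \<subseteq> {..<b}" "\<And>v. v \<in> A \<Longrightarrow> p v \<le> q" "0 \<le> q" "0 \<le> \<tau>" "\<tau> \<le> (\<Sum>v\<in>A. p v)"
  defines "t \<equiv> (LEAST t. \<tau> \<le> (\<Sum>v\<in>A \<inter> {..<t}. p v))"
  shows "\<tau> \<le> (\<Sum>v\<in>A \<inter> {..<t}. p v)" "(\<Sum>v\<in>A \<inter> {..<t}. p v) \<le> \<tau> + q" "t \<le> b"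
proof -
  have b: "\<tau> \<le> (\<Sum>v\<in>A \<inter> {..<b}. p v)" using assms(2,6) by (simp add: Int_absorb2)
  show "\<tau> \<le> (\<Sum>v\<in>A \<inter> {..<t}. p v)" unfolding t_def by (rule LeastI) (rule b)
  show "t \<le> b" unfolding t_def by (rule Least_le) (rule b)
  show "(\<Sum>v\<in>A \<inter> {..<t}. p v) \<le> \<tau> + q"
  proof (cases t)
    case 0
    then show ?thesis using assms by simp
  next
    case (Suc i)
    then have "(\<Sum>v\<in>A \<inter> {..<i}. p v) < \<tau>"
      using not_less_Least[of i "\<lambda>t. \<tau> \<le> (\<Sum>v\<in>A \<inter> {..<t}. p v)"] by (simp add: t_def)
    moreover have "(\<Sum>v\<in>A \<inter> {..<t}. p v) \<le> (\<Sum>v\<in>A \<inter> {..<i}. p v) + q"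
      using assms(1,3,4) by (cases "i \<in> A") (auto simp: Suc lessThan_Suc Int_insert_right)
    ultimately show ?thesis by linarith
  qed
qed

section \<open>Deterministic estimates for one phase\<close>

locale phase = nbr_graph +
  fixes U :: "nat set" and d :: "nat \<Rightarrow> nat" and t :: "nat \<Rightarrow> nat"
  assumes U_subset: "U \<subseteq> X"
    and d_eq: "x \<in> U \<Longrightarrow> d x = card (N x \<inter> U)"
begin

lemma finite_U: "finite U" using U_subset finite_X finite_subset by blast

lemma finite_N: "x \<in> U \<Longrightarrow> finite (N x)"
  using U_subset N_subset finite_X finite_subset by blast

abbreviation "lo w \<equiv> low U d w (N w)"
abbreviation "hi w \<equiv> high U d w (N w)"
abbreviation "sh w \<equiv> lo w \<inter> {..<t w}"

lemma finite_lo: "finite (lo w)" and finite_hi: "finite (hi w)"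
  by (rule finite_subset[OF _ finite_U], auto simp: low_def high_def)+

lemma card_hi_le: "x \<in> U \<Longrightarrow> card (hi x) \<le> d x"
  unfolding d_eq by (rule card_mono) (auto simp: high_def finite_N)

lemma card_lo_le: "x \<in> U \<Longrightarrow> card (lo x) \<le> d x"
  unfolding d_eq by (rule card_mono) (auto simp: low_def finite_N)

lemma d_pos: "x \<in> U \<Longrightarrow> y \<in> N x \<Longrightarrow> y \<in> U \<Longrightarrow> 0 < d y"
  unfolding d_eq by (subst card_gt_0_iff) (use N_sym U_subset finite_N in blast)

text \<open>Double counting: \<open>w\<close> is in \<open>hi v\<close> with \<open>v < t w\<close>
  exactly if \<open>v\<close> is in \<open>sh w\<close>. The penalty that \<open>v\<close> computes
  from its own neighbourhood thus reappears at the nodes that count \<open>v\<close> as a candidate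
  dominator.\<close>

lemma sum_gain:
  assumes "M \<subseteq> U"
  shows "(\<Sum>x\<in>U. gain U d t M x (N x)) =
    (\<Sum>w\<in>U. int (d w) * (int (card (sh w \<inter> M)) - int (card (sh w \<inter> M)) * (int (card (sh w \<inter> M)) - 1)
        - (\<Sum>v\<in>sh w \<inter> M. int (card (hi v \<inter> M)))))"
proof -
  define K where "K v w \<longleftrightarrow> w \<in> N v \<and> prio (d v) \<le> prio (d w) \<and> v < t w" for v w
  have "(\<Sum>v\<in>U. if v \<in> M then int (card (hi v \<inter> M)) * (\<Sum>w | w \<in> hi v \<and> v < t w. int (d w)) else 0)
     = (\<Sum>v\<in>M. \<Sum>w | w \<in> U \<and> K v w. int (card (hi v \<inter> M)) * int (d w))"
  proof -
    have "(\<Sum>v\<in>U. if v \<in> M then int (card (hi v \<inter> M)) * (\<Sum>w | w \<in> hi v \<and> v < t w. int (d w)) else 0)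
      = (\<Sum>v\<in>{v \<in> U. v \<in> M}. int (card (hi v \<inter> M)) * (\<Sum>w | w \<in> hi v \<and> v < t w. int (d w)))"
      by (rule sum.inter_filter[symmetric]) (rule finite_U)
    also have "{v \<in> U. v \<in> M} = M" using assms by auto
    finally show ?thesis
      unfolding sum_distrib_left
      by (simp add: high_def K_def conj_ac cong: conj_cong)
  qed
  also have "\<dots> = (\<Sum>w\<in>U. \<Sum>v | v \<in> M \<and> K v w. int (card (hi v \<inter> M)) * int (d w))"
    by (rule sum.swap_restrict) (use assms finite_U finite_subset in auto)
  also have "\<dots> = (\<Sum>w\<in>U. int (d w) * (\<Sum>v\<in>sh w \<inter> M. int (card (hi v \<inter> M))))"
  proof (rule sum.cong[OF refl])
    fix w assume "w \<in> U"
    then have "{v. v \<in> M \<and> K v w} = sh w \<inter> M"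
      using assms U_subset N_sym by (auto simp: K_def low_def)
    then show "(\<Sum>v | v \<in> M \<and> K v w. int (card (hi v \<inter> M)) * int (d w))
        = int (d w) * (\<Sum>v\<in>sh w \<inter> M. int (card (hi v \<inter> M)))"
      by (simp add: sum_distrib_left mult.commute)
  qed
  finally have eq: "(\<Sum>v\<in>U. if v \<in> M then int (card (hi v \<inter> M)) * (\<Sum>w | w \<in> hi v \<and> v < t w. int (d w)) else 0)
    = (\<Sum>w\<in>U. int (d w) * (\<Sum>v\<in>sh w \<inter> M. int (card (hi v \<inter> M))))" .
  show ?thesis
    unfolding gain_def Let_def sum_subtractf eq by (simp add: right_diff_distrib sum_subtractf)
qed

text \<open>Holds separately at each \<open>w\<close>, with \<open>y\<close> marked candidates. The
  bracket never exceeds 1 because \<open>(y - 1) * (y - 1) \<ge> 0\<close>. If no neighbour of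
  \<open>w\<close> wins, every marked candidate is blocked, the penalty is at least
  \<open>y\<close>, and the bracket is at most 0.\<close>

lemma sum_gain_le:
  assumes "M \<subseteq> U"
  shows "(\<Sum>x\<in>U. gain U d t M x (N x))
    \<le> (\<Sum>w | w \<in> U \<and> (\<exists>v\<in>N w. winner U d M v (N v)). int (d w))"
proof -
  have "(\<Sum>x\<in>U. gain U d t M x (N x))
    \<le> (\<Sum>w\<in>U. if \<exists>v\<in>N w. winner U d M v (N v) then int (d w) else 0)"
    unfolding sum_gain[OF assms]
  proof (rule sum_mono)
    fix w assume w: "w \<in> U"
    let ?Y = "sh w \<inter> M" and ?y = "int (card (sh w \<inter> M))"
    let ?b = "\<Sum>v\<in>?Y. int (card (hi v \<inter> M))"
    have b0: "?b \<ge> 0" by (intro sum_nonneg) auto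
    have "(?y - 1) * (?y - 1) \<ge> 0" by simp
    then have y1: "?y - ?y * (?y - 1) \<le> 1" by (simp add: algebra_simps)
    show "int (d w) * (?y - ?y * (?y - 1) - ?b)
        \<le> (if \<exists>v\<in>N w. winner U d M v (N v) then int (d w) else 0)"
    proof (cases "\<exists>v\<in>N w. winner U d M v (N v)")
      case True
      have "int (d w) * (?y - ?y * (?y - 1) - ?b) \<le> int (d w) * 1"
        using b0 y1 by (intro mult_left_mono) auto
      then show ?thesis using True by simp
    next
      case False
      have "1 \<le> card (hi v \<inter> M)" if "v \<in> ?Y" for v
      proof -
        have "hi v \<inter> M \<noteq> {}" using that False by (auto simp: winner_def low_def)
        then show ?thesis using finite_hi by (simp add: Suc_le_eq card_gt_0_iff)
      qed
      then have "(\<Sum>v\<in>?Y. 1) \<le> ?b" by (intro sum_mono) fastforce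
      then have "?y \<le> ?b" by simp
      moreover have "?y * (?y - 1) \<ge> 0" by (cases "card ?Y") auto
      ultimately have "int (d w) * (?y - ?y * (?y - 1) - ?b) \<le> 0"
        by (intro mult_nonneg_nonpos) auto
      then show ?thesis using False by simp
    qed
  qed
  also have "\<dots> = (\<Sum>w | w \<in> U \<and> (\<exists>v\<in>N w. winner U d M v (N v)). int (d w))"
    by (subst sum.inter_filter[symmetric]) (auto simp: finite_U)
  finally show ?thesis .
qed

text \<open>Every edge puts each of its ends into \<open>low\<close> or \<open>high\<close> of the
  other, and by symmetry of the edges both kinds have the same total.\<close>

lemma sum_card_lo: "(\<Sum>w\<in>U. d w) \<le> 2 * (\<Sum>w\<in>U. card (lo w))"
proof -
  let ?K = "\<lambda>v w. w \<in> N v \<and> prio (d v) \<le> prio (d w)"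
  have "(\<Sum>w\<in>U. card (lo w)) = (\<Sum>w\<in>U. \<Sum>v | v \<in> U \<and> ?K v w. 1)"
  proof (rule sum.cong[OF refl])
    fix w assume "w \<in> U"
    then have "lo w = {v. v \<in> U \<and> ?K v w}"
      using U_subset N_sym by (auto simp: low_def)
    then show "card (lo w) = (\<Sum>v | v \<in> U \<and> ?K v w. 1)" by simp
  qed
  also have "\<dots> = (\<Sum>v\<in>U. \<Sum>w | w \<in> U \<and> ?K v w. 1)"
    by (rule sum.swap_restrict[symmetric]) (auto simp: finite_U)
  also have "\<dots> = (\<Sum>v\<in>U. card (hi v))"
    by (simp add: high_def conj_ac cong: conj_cong)
  finally have eq: "(\<Sum>w\<in>U. card (lo w)) = (\<Sum>v\<in>U. card (hi v))" .
  have "d w \<le> card (lo w) + card (hi w)" if "w \<in> U" for w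
  proof -
    have "N w \<inter> U = lo w \<union> hi w" by (auto simp: low_def high_def)
    then show ?thesis using that card_Un_le[of "lo w" "hi w"] by (simp add: d_eq)
  qed
  then have "(\<Sum>w\<in>U. d w) \<le> (\<Sum>w\<in>U. card (lo w) + card (hi w))" by (rule sum_mono)
  then show ?thesis by (simp add: sum.distrib eq)
qed

lemma prob_pos: "prob d x > 0" by (simp add: prob_def)

lemma d_prob_le: "real (d x) * prob d x \<le> 1 / 32"
proof -
  have "real (32 * d x) \<le> real (2 ^ prio (d x))" using prio_ge of_nat_mono by blast
  then show ?thesis by (simp add: prob_def field_simps)
qed

lemma prob_ge: "0 < d x \<Longrightarrow> 1 / 64 \<le> real (d x) * prob d x"
proof -
  assume "0 < d x"
  then have "real (2 ^ prio (d x)) \<le> real (64 * d x)"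
    using prio_less[of "d x"] of_nat_mono less_imp_le by blast
  then show ?thesis by (simp add: prob_def field_simps)
qed

lemma prob_mono: "prio (d x) \<le> prio (d y) \<Longrightarrow> prob d y \<le> prob d x"
  by (simp add: prob_def divide_simps)

text \<open>The threshold is at most \<open>d w * prob d w \<le> 1 / 32\<close>, and a single term
  is at most 1 / 32 because a candidate has \<open>w\<close> as residual neighbour; together 1 / 16.
  The threshold is reached because candidates are marked at least as often as
  \<open>w\<close>.\<close>

lemma cutoff_props:
  assumes "w \<in> U" "t w = cutoff U d w (N w)"
  shows "card (lo w) * prob d w \<le> (\<Sum>v\<in>sh w. prob d v)" "(\<Sum>v\<in>sh w. prob d v) \<le> 1 / 16"
    and "U \<subseteq> {..<b} \<Longrightarrow> t w \<le> b"
proof -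
  have q: "prob d v \<le> 1 / 32" if "v \<in> lo w" for v
  proof -
    have "1 * prob d v \<le> real (d v) * prob d v"
      using d_pos[of w v] that assms prob_pos[of v]
      by (intro mult_right_mono) (auto simp: low_def Suc_le_eq)
    then show ?thesis using d_prob_le[of v] by linarith
  qed
  have "(\<Sum>v\<in>lo w. prob d w) \<le> (\<Sum>v\<in>lo w. prob d v)"
    by (intro sum_mono prob_mono) (auto simp: low_def)
  then have \<tau>: "card (lo w) * prob d w \<le> (\<Sum>v\<in>lo w. prob d v)" by simp
  have "card (lo w) * prob d w \<le> d w * prob d w"
    using card_lo_le[OF assms(1)] prob_pos[of w] by (intro mult_right_mono) auto
  then have \<tau>2: "card (lo w) * prob d w \<le> 1 / 32" using d_prob_le[of w] by linarith
  have \<tau>0: "0 \<le> card (lo w) * prob d w" using prob_pos[of w] by simp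
  obtain b0 where b0: "lo w \<subseteq> {..<b0}" using finite_lo finite_nat_set_iff_bounded by (metis lessThan_iff subsetI)
  note P = Least_prefix_sum[OF finite_lo _ q _ \<tau>0 \<tau>, folded cutoff_def assms(2)]
  show "card (lo w) * prob d w \<le> (\<Sum>v\<in>sh w. prob d v)" using P(1)[OF b0] by simp
  show "(\<Sum>v\<in>sh w. prob d v) \<le> 1 / 16" using P(2)[OF b0] \<tau>2 by simp
  show "t w \<le> b" if "U \<subseteq> {..<b}" using P(3)[of b] that by (auto simp: low_def)
qed

end

section \<open>Averages over all seeds\<close>

lemma real_card_Int:
  "finite S \<Longrightarrow> real (card (S \<inter> M)) = (\<Sum>v\<in>S. of_bool (v \<in> M))"
  using sum.inter_restrict[of S "\<lambda>_. 1 :: real" M] by (simp add: of_bool_def)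

lemma sum_of_bool_seeds:
  "(\<Sum>s<q. of_bool (P s)) = real (card {s. s < q \<and> P s})" for q :: nat
  using real_card_Int[of "{..<q}" "{s. P s}"] by (simp add: Int_def)

text \<open>Turns the quadratic estimator into a combination of indicators of single marks and of
  ordered pairs, the only events whose frequencies \<open>marking\<close> controls.\<close>

lemma card_minus_card_pairs:
  assumes "finite S"
  shows "(let y = real (card (S \<inter> M)) in y - y * (y - 1)) =
    (\<Sum>v\<in>S. of_bool (v \<in> M) - (\<Sum>u\<in>S - {v}. of_bool (v \<in> M \<and> u \<in> M)))"
proof -
  let ?e = "\<lambda>v. of_bool (v \<in> M) :: real"
  have y: "real (card (S \<inter> M)) = (\<Sum>v\<in>S. ?e v)" by (rule real_card_Int[OF assms])
  have "(\<Sum>u\<in>S - {v}. of_bool (v \<in> M \<and> u \<in> M)) = ?e v * (\<Sum>u\<in>S. ?e u) - ?e v" if "v \<in> S" for v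
  proof -
    have "(\<Sum>u\<in>S - {v}. of_bool (v \<in> M \<and> u \<in> M)) = ?e v * (\<Sum>u\<in>S - {v}. ?e u)"
      by (simp only: of_bool_conj sum_distrib_left)
    also have "(\<Sum>u\<in>S - {v}. ?e u) = (\<Sum>u\<in>S. ?e u) - ?e v"
      using that assms by (simp only: sum_diff1 if_True)
    finally show ?thesis by (cases "v \<in> M") simp_all
  qed
  then have "(\<Sum>v\<in>S. ?e v - (\<Sum>u\<in>S - {v}. of_bool (v \<in> M \<and> u \<in> M)))
     = (\<Sum>v\<in>S. ?e v - (?e v * (\<Sum>u\<in>S. ?e u) - ?e v))"
    by (intro sum.cong) auto
  also have "\<dots> = (\<Sum>v\<in>S. ?e v) - ((\<Sum>v\<in>S. ?e v) * (\<Sum>u\<in>S. ?e u) - (\<Sum>v\<in>S. ?e v))"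
    by (simp only: sum_subtractf sum_distrib_right)
  finally show ?thesis by (simp add: Let_def y right_diff_distrib)
qed

locale marked_phase = phase +
  fixes mk :: "nat \<Rightarrow> nat \<Rightarrow> nat \<Rightarrow> bool" and b m L :: nat
  assumes mk: "marking b m L mk" and X_less: "X \<subseteq> {..<b}"
    and prio_le: "x \<in> U \<Longrightarrow> prio (d x) \<le> m"
    and t_eq: "x \<in> U \<Longrightarrow> t x = cutoff U d x (N x)"
begin

definition marked :: "nat \<Rightarrow> nat set" where
  "marked s = {x \<in> U. mk s x (prio (d x))}"

lemma marked_single:
  assumes "v \<in> U"
  shows "(\<Sum>s<2 ^ L. of_bool (v \<in> marked s)) = 2 ^ L * prob d v"
proof -
  have "real (card {s. s < 2 ^ L \<and> mk s v (prio (d v))} * 2 ^ prio (d v)) = real (2 ^ L)"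
    using mk prio_le[OF assms] by (simp only: marking_def)
  then have "real (card {s. s < 2 ^ L \<and> mk s v (prio (d v))}) = 2 ^ L * prob d v"
    by (simp add: prob_def field_simps)
  then show ?thesis using assms by (simp only: sum_of_bool_seeds marked_def mem_Collect_eq simp_thms)
qed

lemma marked_pair:
  assumes "v \<in> U" "u \<in> U" "v \<noteq> u"
  shows "(\<Sum>s<2 ^ L. of_bool (v \<in> marked s \<and> u \<in> marked s)) \<le> 2 ^ L * prob d v * (4 * prob d u)"
proof -
  let ?c = "card {s. s < 2 ^ L \<and> mk s v (prio (d v)) \<and> mk s u (prio (d u))}"
  have "?c * 2 ^ (prio (d v) + prio (d u)) \<le> 4 * 2 ^ L"
    using mk X_less assms U_subset prio_le unfolding marking_def by blast
  then have "real (?c * 2 ^ (prio (d v) + prio (d u))) \<le> real (4 * 2 ^ L)" by (rule of_nat_mono)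
  then have "real ?c \<le> 2 ^ L * prob d v * (4 * prob d u)"
    by (simp add: prob_def field_simps power_add)
  then show ?thesis using assms by (simp only: sum_of_bool_seeds marked_def mem_Collect_eq simp_thms)
qed

text \<open>Origin of 256: a factor 2 for the loss to double marks and blockers, 64 from
  \<open>d w * prob d w \<ge> 1 / 64\<close>, and 2 because the candidates account for at least half
  of all arcs.\<close>

lemma sum_seeds_gain:
  "2 ^ L * (\<Sum>x\<in>U. int (d x)) \<le> 256 * (\<Sum>s<2 ^ L. \<Sum>x\<in>U. gain U d t (marked s) x (N x))"
proof -
  let ?p = "prob d"
  let ?e = "\<lambda>s v. of_bool (v \<in> marked s) :: real"
  let ?e2 = "\<lambda>s v u. of_bool (v \<in> marked s \<and> u \<in> marked s) :: real"
  define g where "g s w = (\<Sum>v\<in>sh w. ?e s v - (\<Sum>u\<in>sh w - {v}. ?e2 s v u) - (\<Sum>u\<in>hi v. ?e2 s v u))" for s w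
  have M: "marked s \<subseteq> U" for s by (auto simp: marked_def)
  have gain_eq: "real_of_int (\<Sum>x\<in>U. gain U d t (marked s) x (N x)) = (\<Sum>w\<in>U. real (d w) * g s w)" for s
  proof -
    have hi_eq: "(\<Sum>v\<in>sh w \<inter> marked s. real (card (hi v \<inter> marked s))) = (\<Sum>v\<in>sh w. \<Sum>u\<in>hi v. ?e2 s v u)" for w
    proof -
      have "(\<Sum>v\<in>sh w \<inter> marked s. real (card (hi v \<inter> marked s)))
        = (\<Sum>v\<in>sh w. if v \<in> marked s then real (card (hi v \<inter> marked s)) else 0)"
        by (rule sum.inter_restrict) (use finite_lo in auto)
      also have "\<dots> = (\<Sum>v\<in>sh w. \<Sum>u\<in>hi v. ?e2 s v u)"
      proof (rule sum.cong[OF refl])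
        fix v
        show "(if v \<in> marked s then real (card (hi v \<inter> marked s)) else 0) = (\<Sum>u\<in>hi v. ?e2 s v u)"
        proof (cases "v \<in> marked s")
          case True
          then show ?thesis using real_card_Int[OF finite_hi, of v "marked s"] by (simp only: if_True simp_thms)
        next
          case False
          then show ?thesis by simp
        qed
      qed
      finally show ?thesis .
    qed
    have "real_of_int (\<Sum>x\<in>U. gain U d t (marked s) x (N x)) = (\<Sum>w\<in>U. real (d w) *
       ((let y = real (card (sh w \<inter> marked s)) in y - y * (y - 1))
          - (\<Sum>v\<in>sh w \<inter> marked s. real (card (hi v \<inter> marked s)))))"
      unfolding sum_gain[OF M] by (simp add: Let_def)
    also have "\<dots> = (\<Sum>w\<in>U. real (d w) * g s w)"
    proof -
      have "finite (sh w)" for w using finite_lo by blast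
      then show ?thesis
        by (simp only: card_minus_card_pairs hi_eq g_def sum_subtractf)
    qed
    finally show ?thesis .
  qed
  have g_sum: "2 ^ L * real (card (lo w)) \<le> 128 * (real (d w) * (\<Sum>s<2 ^ L. g s w))" if w: "w \<in> U" for w
  proof -
    have sub: "sh w \<subseteq> U" by (auto simp: low_def)
    have fin: "finite (sh w)" using finite_lo by blast
    note c = cutoff_props[OF w t_eq[OF w]]
    have "(\<Sum>s<2 ^ L. g s w) = (\<Sum>v\<in>sh w. (\<Sum>s<2 ^ L. ?e s v)
       - (\<Sum>u\<in>sh w - {v}. \<Sum>s<2 ^ L. ?e2 s v u) - (\<Sum>u\<in>hi v. \<Sum>s<2 ^ L. ?e2 s v u))"
      unfolding g_def
      by (subst sum.swap) (simp only: sum_subtractf sum.swap[of _ _ "{..<2 ^ L}"])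
    also have "\<dots> \<ge> (\<Sum>v\<in>sh w. 2 ^ L * ?p v * (1 / 2))"
    proof (rule sum_mono)
      fix v assume v: "v \<in> sh w"
      have vU: "v \<in> U" "v \<in> X" using v sub U_subset by auto
      have "(\<Sum>u\<in>sh w - {v}. \<Sum>s<2 ^ L. ?e2 s v u) \<le> (\<Sum>u\<in>sh w - {v}. 2 ^ L * ?p v * (4 * ?p u))"
        by (intro sum_mono marked_pair vU) (use sub in auto)
      also have "\<dots> \<le> (\<Sum>u\<in>sh w. 2 ^ L * ?p v * (4 * ?p u))"
        by (intro sum_mono2 fin) (auto simp: prob_def)
      also have "\<dots> = 2 ^ L * ?p v * (4 * (\<Sum>u\<in>sh w. ?p u))" by (simp add: sum_distrib_left)
      also have "\<dots> \<le> 2 ^ L * ?p v * (4 * (1 / 16))"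
        using c(2) prob_pos[of v] by (intro mult_left_mono) auto
      finally have A: "(\<Sum>u\<in>sh w - {v}. \<Sum>s<2 ^ L. ?e2 s v u) \<le> 2 ^ L * ?p v * (1 / 4)" by simp
      \<comment> \<open>Blockers are marked no more often than \<open>v\<close> itself, so their
        total mass is at most \<open>d v * prob d v\<close>; unlike for \<open>low\<close>, this is
        small without truncation.\<close>
      have "(\<Sum>u\<in>hi v. \<Sum>s<2 ^ L. ?e2 s v u) \<le> (\<Sum>u\<in>hi v. 2 ^ L * ?p v * (4 * ?p v))"
      proof (rule sum_mono)
        fix u assume u: "u \<in> hi v"
        then have "u \<in> U" "v \<noteq> u" using N_irrefl[OF vU(2)] by (auto simp: high_def)
        then have "(\<Sum>s<2 ^ L. ?e2 s v u) \<le> 2 ^ L * ?p v * (4 * ?p u)" by (intro marked_pair vU)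
        also have "\<dots> \<le> 2 ^ L * ?p v * (4 * ?p v)"
          using u prob_pos[of v] prob_mono[of v u] by (intro mult_left_mono) (auto simp: high_def)
        finally show "(\<Sum>s<2 ^ L. ?e2 s v u) \<le> 2 ^ L * ?p v * (4 * ?p v)" .
      qed
      also have "\<dots> = 2 ^ L * ?p v * (4 * (card (hi v) * ?p v))" by simp
      also have "\<dots> \<le> 2 ^ L * ?p v * (4 * (1 / 32))"
      proof -
        have "card (hi v) * ?p v \<le> d v * ?p v"
          using card_hi_le[OF vU(1)] prob_pos[of v] by (intro mult_right_mono) auto
        then have "card (hi v) * ?p v \<le> 1 / 32" using d_prob_le[of v] by linarith
        then show ?thesis using prob_pos[of v] by (intro mult_left_mono) auto
      qed
      finally have B: "(\<Sum>u\<in>hi v. \<Sum>s<2 ^ L. ?e2 s v u) \<le> 2 ^ L * ?p v * (1 / 8)" by simp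
      have pos: "0 \<le> 2 ^ L * ?p v" using prob_pos[of v] by simp
      show "2 ^ L * ?p v * (1 / 2) \<le> (\<Sum>s<2 ^ L. ?e s v)
         - (\<Sum>u\<in>sh w - {v}. \<Sum>s<2 ^ L. ?e2 s v u) - (\<Sum>u\<in>hi v. \<Sum>s<2 ^ L. ?e2 s v u)"
        unfolding marked_single[OF vU(1)] using A B pos by argo
    qed
    also have "(\<Sum>v\<in>sh w. 2 ^ L * ?p v * (1 / 2)) = 2 ^ L / 2 * (\<Sum>v\<in>sh w. ?p v)"
      by (simp add: sum_distrib_left)
    finally have "2 ^ L / 2 * (card (lo w) * ?p w) \<le> (\<Sum>s<2 ^ L. g s w)"
      by (rule order_trans[OF mult_left_mono[OF c(1)], rotated]) simp
    then have "real (d w) * (2 ^ L / 2 * (card (lo w) * ?p w)) \<le> real (d w) * (\<Sum>s<2 ^ L. g s w)"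
      by (intro mult_left_mono) auto
    moreover have "2 ^ L * real (card (lo w)) * (1 / 64) \<le> 2 ^ L * real (card (lo w)) * (real (d w) * ?p w)"
    proof (cases "d w = 0")
      case True
      then show ?thesis using card_lo_le[OF w] by simp
    next
      case False
      then show ?thesis by (intro mult_left_mono prob_ge) auto
    qed
    moreover have "real (d w) * (2 ^ L / 2 * (card (lo w) * ?p w))
        = 2 ^ L * real (card (lo w)) * (real (d w) * ?p w) / 2"
      by simp
    ultimately show ?thesis by linarith
  qed
  have "2 ^ L * real (\<Sum>x\<in>U. d x) \<le> 2 ^ L * real (2 * (\<Sum>w\<in>U. card (lo w)))"
    using sum_card_lo by (intro mult_left_mono of_nat_mono) auto
  also have "\<dots> = 2 * (\<Sum>w\<in>U. 2 ^ L * real (card (lo w)))" by (simp add: sum_distrib_left mult_ac)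
  also have "\<dots> \<le> 2 * (\<Sum>w\<in>U. 128 * (real (d w) * (\<Sum>s<2 ^ L. g s w)))"
    by (intro mult_left_mono sum_mono g_sum) auto
  also have "\<dots> = 256 * (\<Sum>s<2 ^ L. \<Sum>w\<in>U. real (d w) * g s w)"
    by (subst sum.swap) (simp add: sum_distrib_left)
  also have "\<dots> = real_of_int (256 * (\<Sum>s<2 ^ L. \<Sum>x\<in>U. gain U d t (marked s) x (N x)))"
    unfolding gain_eq[symmetric] by simp
  finally have "real_of_int (2 ^ L * (\<Sum>x\<in>U. int (d x)))
      \<le> real_of_int (256 * (\<Sum>s<2 ^ L. \<Sum>x\<in>U. gain U d t (marked s) x (N x)))"
    by simp
  then show ?thesis by (simp only: of_int_le_iff)
qed

text \<open>A seed that is at least as good as the average dominates nodes carrying 1 / 256 of the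
  arcs, and all arcs starting there vanish. \<open>U'\<close> is bounded only from above, since the
  winners leave as well.\<close>

lemma phase_progress:
  assumes s: "(\<Sum>s'<2 ^ L. \<Sum>x\<in>U. gain U d t (marked s') x (N x))
      \<le> 2 ^ L * (\<Sum>x\<in>U. gain U d t (marked s) x (N x))"
    and U': "U' \<subseteq> {x \<in> U. \<forall>v\<in>N x. \<not> winner U d (marked s) v (N v)}"
  shows "256 * (\<Sum>x\<in>U'. card (N x \<inter> U')) \<le> 255 * (\<Sum>x\<in>U. card (N x \<inter> U))"
proof -
  let ?K = "{w. w \<in> U \<and> (\<exists>v\<in>N w. winner U d (marked s) v (N v))}"
  have M: "marked s \<subseteq> U" by (auto simp: marked_def)
  have "2 ^ L * (\<Sum>x\<in>U. int (d x)) \<le> 256 * (2 ^ L * (\<Sum>x\<in>U. gain U d t (marked s) x (N x)))"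
    using sum_seeds_gain s by linarith
  then have "2 ^ L * (\<Sum>x\<in>U. int (d x)) \<le> 2 ^ L * (256 * (\<Sum>x\<in>U. gain U d t (marked s) x (N x)))"
    by (simp only: mult.left_commute)
  then have "(\<Sum>x\<in>U. int (d x)) \<le> 256 * (\<Sum>x\<in>U. gain U d t (marked s) x (N x))" by simp
  also have "\<dots> \<le> 256 * (\<Sum>w\<in>?K. int (d w))" using sum_gain_le[OF M] by simp
  finally have "int (\<Sum>x\<in>U. d x) \<le> int (256 * (\<Sum>w\<in>?K. d w))" by simp
  then have 1: "(\<Sum>x\<in>U. d x) \<le> 256 * (\<Sum>w\<in>?K. d w)" by (simp only: of_nat_le_iff)
  have U'U: "U' \<subseteq> U" using U' by auto
  have "(\<Sum>x\<in>U'. card (N x \<inter> U')) \<le> (\<Sum>x\<in>U'. d x)"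
  proof (rule sum_mono)
    fix x assume "x \<in> U'"
    then have x: "x \<in> U" using U'U by auto
    show "card (N x \<inter> U') \<le> d x"
      unfolding d_eq[OF x] by (rule card_mono) (use finite_N[OF x] U'U in auto)
  qed
  also have "\<dots> \<le> (\<Sum>x\<in>U - ?K. d x)" by (rule sum_mono2) (use finite_U U' in auto)
  finally have "(\<Sum>x\<in>U'. card (N x \<inter> U')) + (\<Sum>x\<in>?K. d x) \<le> (\<Sum>x\<in>U. d x)"
    using sum.subset_diff[of ?K U d] finite_U by auto
  moreover have "(\<Sum>x\<in>U. card (N x \<inter> U)) = (\<Sum>x\<in>U. d x)" by (simp add: d_eq)
  ultimately show ?thesis using 1 by linarith
qed

end

section \<open>Broadcast programs\<close>

text \<open>Everything that is broadcast is public, so an algorithm is a tree that branches on what was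
  heard; only the messages depend on the identifier and the neighbourhood of the sender.\<close>

datatype 'a prog = Ret 'a | Bcast "nat \<Rightarrow> nat set \<Rightarrow> nat" "(nat \<Rightarrow> nat option) \<Rightarrow> 'a prog"

primrec bind :: "'a prog \<Rightarrow> ('a \<Rightarrow> 'b prog) \<Rightarrow> 'b prog" where
  "bind (Ret a) f = f a"
| "bind (Bcast \<mu> c) f = Bcast \<mu> (\<lambda>r. bind (c r) f)"

definition heard :: "nat set \<Rightarrow> (nat \<Rightarrow> nat set) \<Rightarrow> (nat \<Rightarrow> nat set \<Rightarrow> nat) \<Rightarrow> nat \<Rightarrow> nat option" where
  "heard X N \<mu> = (\<lambda>i. if i \<in> X then Some (\<mu> i (N i)) else None)"

text \<open>The message bound \<open>B\<close> and the exact number of rounds are part of a run, so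
  that \<open>spec\<close> composes correctness, message size and cost together.\<close>

inductive run :: "nat set \<Rightarrow> (nat \<Rightarrow> nat set) \<Rightarrow> nat \<Rightarrow> 'a prog \<Rightarrow> nat \<Rightarrow> 'a \<Rightarrow> bool"
  for X N B where
  run_Ret: "run X N B (Ret a) 0 a"
| run_Bcast: "\<forall>x\<in>X. \<mu> x (N x) < B \<Longrightarrow> run X N B (c (heard X N \<mu>)) T a \<Longrightarrow> run X N B (Bcast \<mu> c) (Suc T) a"

lemma run_bind:
  "run X N B p T a \<Longrightarrow> run X N B (f a) T' b \<Longrightarrow> run X N B (bind p f) (T + T') b"
  by (induction rule: run.induct) (auto intro: run_Bcast)

definition spec :: "nat set \<Rightarrow> (nat \<Rightarrow> nat set) \<Rightarrow> nat \<Rightarrow> 'a prog \<Rightarrow> nat \<Rightarrow> ('a \<Rightarrow> bool) \<Rightarrow> bool" where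
  "spec X N B p T Q \<longleftrightarrow> (\<exists>a. run X N B p T a \<and> Q a)"

lemma spec_Ret: "Q a \<Longrightarrow> spec X N B (Ret a) 0 Q"
  by (auto simp: spec_def intro: run_Ret)

lemma spec_bind:
  "spec X N B p T R \<Longrightarrow> (\<And>a. R a \<Longrightarrow> spec X N B (f a) T' Q) \<Longrightarrow> spec X N B (bind p f) (T + T') Q"
  unfolding spec_def by (blast intro: run_bind)

lemma spec_mono: "spec X N B p T Q \<Longrightarrow> (\<And>a. Q a \<Longrightarrow> Q' a) \<Longrightarrow> spec X N B p T Q'"
  unfolding spec_def by blast

definition ask :: "(nat \<Rightarrow> nat set \<Rightarrow> nat) \<Rightarrow> (nat \<Rightarrow> nat) prog" where
  "ask \<mu> = Bcast \<mu> (\<lambda>r. Ret (\<lambda>i. the (r i)))"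

lemma spec_ask:
  assumes "\<And>x. x \<in> X \<Longrightarrow> \<mu> x (N x) < B"
  shows "spec X N B (ask \<mu>) (Suc 0) (\<lambda>f. \<forall>x\<in>X. f x = \<mu> x (N x))"
  unfolding spec_def ask_def
  by (intro exI conjI, rule run_Bcast, use assms in blast, rule run_Ret) (auto simp: heard_def)

text \<open>A view starts with the identifiers of the node and its neighbours only. One dummy
  message per node reveals all others through the domain of what is received.\<close>

definition nodes :: "nat set prog" where
  "nodes = Bcast (\<lambda>_ _. 0) (\<lambda>r. Ret (dom r))"

lemma spec_nodes: "0 < B \<Longrightarrow> spec X N B nodes (Suc 0) (\<lambda>Y. Y = X)"
  unfolding spec_def nodes_def
  by (intro exI conjI, rule run_Bcast, simp, rule run_Ret) (auto simp: heard_def split: if_splits)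

section \<open>Programs as functions on views\<close>

primrec receive :: "'a prog \<Rightarrow> (nat \<Rightarrow> nat option) \<Rightarrow> 'a prog" where
  "receive (Ret a) r = Ret a"
| "receive (Bcast \<mu> c) r = c r"

definition msg_of :: "(nat \<Rightarrow> nat set prog) \<Rightarrow> view \<Rightarrow> nat" where
  "msg_of P = (\<lambda>(n, x, A, h). case foldl receive (P n) h of Ret I \<Rightarrow> 0 | Bcast \<mu> c \<Rightarrow> \<mu> x A)"

definition out_of :: "(nat \<Rightarrow> nat set prog) \<Rightarrow> view \<Rightarrow> bool option" where
  "out_of P = (\<lambda>(n, x, A, h). case foldl receive (P n) h of Ret I \<Rightarrow> Some (x \<in> I) | Bcast \<mu> c \<Rightarrow> None)"

definition mis :: "nat set \<Rightarrow> (nat \<Rightarrow> nat set) \<Rightarrow> nat set \<Rightarrow> bool" where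
  "mis X N I \<longleftrightarrow> I \<subseteq> X \<and> (\<forall>x\<in>I. N x \<inter> I = {}) \<and> (\<forall>x\<in>X - I. N x \<inter> I \<noteq> {})"

definition id_nbrs :: "nat \<Rightarrow> (nat \<Rightarrow> nat \<Rightarrow> bool) \<Rightarrow> (nat \<Rightarrow> nat) \<Rightarrow> nat \<Rightarrow> nat set" where
  "id_nbrs n E idf x = {idf u | u. u < n \<and> E (the_inv_into {..<n} idf x) u}"

text \<open>All nodes receive the same history, so the residual program \<open>q t\<close> is common
  to them, and only the message it prescribes depends on the node. Induction along the run then
  follows \<open>q\<close>.\<close>

lemma computes_MIS_within_prog:
  assumes inj: "inj_on idf {..<n}"
    and spec: "spec (idf ` {..<n}) (id_nbrs n E idf) ((n + 2) ^ c) (P n) T (mis (idf ` {..<n}) (id_nbrs n E idf))"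
  shows "computes_MIS_within (msg_of P) (out_of P) c T n E idf"
proof -
  let ?X = "idf ` {..<n}" and ?N = "id_nbrs n E idf" and ?B = "(n + 2) ^ c"
  let ?V = "views (msg_of P) n E idf"
  define r where "r t = (\<lambda>i. if i \<in> ?X then Some (msg_of P (?V t (the_inv_into {..<n} idf i))) else None)" for t
  have inv: "the_inv_into {..<n} idf (idf v) = v" if "v < n" for v
    using inj that by (simp add: the_inv_into_f_f)
  have N: "?N (idf v) = {idf u | u. u < n \<and> E v u}" if "v < n" for v
    by (simp add: id_nbrs_def inv[OF that])
  have V: "?V t v = (n, idf v, {idf u | u. u < n \<and> E v u}, map r [0..<t])" for t v
    by (induction t) (simp_all add: Let_def r_def[abs_def])
  define q where "q t = foldl receive (P n) (map r [0..<t])" for t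
  have q_Suc: "q (Suc t) = receive (q t) (r t)" for t by (simp add: q_def)
  have msg: "msg_of P (?V t v) = (case q t of Ret I \<Rightarrow> 0 | Bcast \<mu> c \<Rightarrow> \<mu> (idf v) (?N (idf v)))"
    if "v < n" for t v
    unfolding V N[OF that] by (simp add: msg_of_def q_def)
  have out: "out_of P (?V t v) = (case q t of Ret I \<Rightarrow> Some (idf v \<in> I) | Bcast \<mu> c \<Rightarrow> None)" for t v
    unfolding V by (simp add: out_of_def q_def)
  have r_eq: "r t = heard ?X ?N \<mu>" if "q t = Bcast \<mu> c" for t \<mu> c
    unfolding r_def heard_def by (rule ext) (auto simp: inv msg that)
  have main: "q (t + T) = Ret I \<and> (\<forall>s<T. \<forall>v<n. msg_of P (?V (t + s) v) < ?B)"
    if "run ?X ?N ?B p T I" "p = q t" for p t T I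
    using that
  proof (induction arbitrary: t rule: run.induct)
    case (run_Ret a)
    then show ?case by simp
  next
    case (run_Bcast \<mu> c T a)
    have "q (Suc t) = c (heard ?X ?N \<mu>)"
      using r_eq[of t] run_Bcast.prems[symmetric] by (simp add: q_Suc)
    then have IH: "q (Suc t + T) = Ret a" "\<And>s v. s < T \<Longrightarrow> v < n \<Longrightarrow> msg_of P (?V (Suc t + s) v) < ?B"
      using run_Bcast.IH[of "Suc t"] by auto
    have "msg_of P (?V (t + s) v) < ?B" if "s < Suc T" "v < n" for s v
    proof (cases s)
      case 0
      then show ?thesis using that run_Bcast.hyps(1) by (simp add: msg flip: run_Bcast.prems)
    next
      case (Suc s')
      then show ?thesis using IH(2)[of s' v] that by simp
    qed
    then show ?case using IH(1) by simp
  qed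
  obtain I where I: "run ?X ?N ?B (P n) T I" "mis ?X ?N I" using spec by (auto simp: spec_def)
  have q0: "P n = q 0" by (simp add: q_def)
  have T: "q T = Ret I" "\<And>s v. s < T \<Longrightarrow> v < n \<Longrightarrow> msg_of P (?V s v) < ?B"
    using main[OF I(1), of 0] q0 by simp_all
  \<comment> \<open>\<open>receive\<close> leaves a finished program unchanged, hence outputs
    persist.\<close>
  have stable: "q t = Ret I" if "t \<ge> T" for t
    using that by (induction rule: dec_induct) (auto simp: T(1) q_Suc)
  have "maximal_independent_set n E {v. v < n \<and> idf v \<in> I}"
    unfolding maximal_independent_set_def independent_set_def
  proof (intro conjI ballI allI impI)
    fix u v assume u: "u \<in> {v. v < n \<and> idf v \<in> I}" and v: "v \<in> {v. v < n \<and> idf v \<in> I}"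
    then have "?N (idf u) \<inter> I = {}" using I(2) by (auto simp: mis_def)
    then show "\<not> E u v" using u v N[of u] by auto
  next
    fix v assume v: "v < n" "v \<notin> {v. v < n \<and> idf v \<in> I}"
    then have "?N (idf v) \<inter> I \<noteq> {}" using I(2) by (auto simp: mis_def)
    then show "\<exists>u\<in>{v. v < n \<and> idf v \<in> I}. E v u" using N[OF v(1)] by auto
  qed auto
  moreover have "{v. v < n \<and> out_of P (?V T v) = Some True} = {v. v < n \<and> idf v \<in> I}"
    by (auto simp: out T(1))
  ultimately show ?thesis
    unfolding computes_MIS_within_def using T(2) by (simp add: out T(1) stable)
qed

lemma nbr_graph_id_nbrs:
  assumes inj: "inj_on idf {..<n}" and E: "simple_graph n E"
  shows "nbr_graph (idf ` {..<n}) (id_nbrs n E idf)"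
    and "v < n \<Longrightarrow> card (id_nbrs n E idf (idf v)) = degree n E v"
proof -
  have inv: "the_inv_into {..<n} idf (idf v) = v" if "v < n" for v
    using inj that by (simp add: the_inv_into_f_f)
  show "nbr_graph (idf ` {..<n}) (id_nbrs n E idf)"
  proof
    fix x assume "x \<in> idf ` {..<n}"
    then show "x \<notin> id_nbrs n E idf x"
      using E inj by (auto simp: id_nbrs_def inv simple_graph_def inj_on_def)
  qed (use E in \<open>auto simp: id_nbrs_def inv simple_graph_def\<close>)
  assume "v < n"
  then have "id_nbrs n E idf (idf v) = idf ` {u. u < n \<and> E v u}"
    by (auto simp: id_nbrs_def inv)
  then show "card (id_nbrs n E idf (idf v)) = degree n E v"
    using inj by (simp add: degree_def card_image inj_on_def)
qed

text \<open>Justifies the \<open>SOME\<close> by which the low-degree branch picks its result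
  locally.\<close>

lemma (in nbr_graph) mis_exists: "\<exists>I. mis X N I"
proof -
  let ?F = "{I. I \<subseteq> X \<and> (\<forall>x\<in>I. N x \<inter> I = {})}"
  have "finite ?F" by (rule finite_subset[of _ "Pow X"]) (auto simp: finite_X)
  moreover have "?F \<noteq> {}" by auto
  ultimately obtain I where I: "I \<in> ?F" "\<forall>J\<in>?F. I \<subseteq> J \<longrightarrow> I = J"
    by (rule finite_has_maximal[THEN bexE])
  have "N x \<inter> I \<noteq> {}" if x: "x \<in> X - I" for x
  proof
    assume no: "N x \<inter> I = {}"
    have "x \<notin> N y" if "y \<in> I" for y using no that I(1) N_sym[of y x] by auto
    then have "insert x I \<in> ?F" using I(1) x no N_irrefl[of x] by auto
    then show False using bspec[OF I(2)] x by blast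
  qed
  then show ?thesis using I(1) by (auto simp: mis_def)
qed

section \<open>The phase as a broadcast program\<close>

text \<open>Conditional expectations: halve the interval of seeds, keeping the better half. The shift by
  \<open>K\<close> makes the messages nonnegative.\<close>

primrec select :: "nat set \<Rightarrow> int \<Rightarrow> (nat \<Rightarrow> nat \<Rightarrow> nat set \<Rightarrow> int) \<Rightarrow> nat \<Rightarrow> nat \<Rightarrow> nat prog" where
  "select X K F 0 b = Ret b"
| "select X K F (Suc l) b =
     bind (ask (\<lambda>x A. nat (K + (\<Sum>s\<in>{b..<b + 2 ^ l}. F s x A)))) (\<lambda>f.
     bind (ask (\<lambda>x A. nat (K + (\<Sum>s\<in>{b + 2 ^ l..<b + 2 ^ Suc l}. F s x A)))) (\<lambda>g.
     select X K F l (if (\<Sum>x\<in>X. int (g x)) \<le> (\<Sum>x\<in>X. int (f x)) then b else b + 2 ^ l)))"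

text \<open>The better half carries at least half of the total, so the sum over an interval never
  exceeds its length times the value at the final seed. A sum over \<open>2 ^ l\<close> seeds is at
  most \<open>K\<close> in absolute value, hence shifted messages lie between 0 and
  \<open>2 * K < B\<close>.\<close>

lemma spec_select:
  assumes F: "\<And>s x. x \<in> X \<Longrightarrow> \<bar>F s x (N x)\<bar> \<le> G"
    and K: "2 ^ l * G \<le> K" "2 * K < int B" and "0 \<le> G"
  shows "spec X N B (select X K F l b) (2 * l)
    (\<lambda>s. (\<Sum>s'\<in>{b..<b + 2 ^ l}. \<Sum>x\<in>X. F s' x (N x)) \<le> 2 ^ l * (\<Sum>x\<in>X. F s x (N x)))"
  using K(1)
proof (induction l arbitrary: b)
  case 0
  show ?case by (auto intro!: spec_Ret)
next
  case (Suc l)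
  let ?F = "\<lambda>s x. F s x (N x)" and ?T = "\<lambda>s. \<Sum>x\<in>X. F s x (N x)"
  have Kl: "2 ^ l * G \<le> K" 
  proof -
    have "0 \<le> 2 ^ l * G" using \<open>0 \<le> G\<close> by simp
    then show ?thesis using Suc.prems unfolding power_Suc mult.assoc by linarith
  qed
  have bound: "\<bar>\<Sum>s\<in>{a..<a + 2 ^ l}. ?F s x\<bar> \<le> K" if "x \<in> X" for a x
  proof -
    have "\<bar>\<Sum>s\<in>{a..<a + 2 ^ l}. ?F s x\<bar> \<le> (\<Sum>s\<in>{a..<a + 2 ^ l}. G)"
      by (rule sum_abs[THEN order_trans]) (intro sum_mono F that)
    then show ?thesis using Kl by simp
  qed
  have msg: "int (nat (K + (\<Sum>s\<in>{a..<a + 2 ^ l}. ?F s x))) = K + (\<Sum>s\<in>{a..<a + 2 ^ l}. ?F s x)"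
    if "x \<in> X" for a x
    using bound[OF that, of a] by linarith
  have less: "nat (K + (\<Sum>s\<in>{a..<a + 2 ^ l}. ?F s x)) < B" if "x \<in> X" for a x
    using bound[OF that, of a] K(2) by linarith
  \<comment> \<open>Both halves receive the same offset \<open>card X * K\<close>, so comparing the
    totals of the messages compares the true sums.\<close>
  have tot: "(\<Sum>x\<in>X. int (f x)) = int (card X) * K + (\<Sum>s\<in>{a..<a + 2 ^ l}. ?T s)"
    if "\<forall>x\<in>X. f x = nat (K + (\<Sum>s\<in>{a..<a + 2 ^ l}. ?F s x))" for f a
  proof -
    have "(\<Sum>x\<in>X. int (f x)) = (\<Sum>x\<in>X. K + (\<Sum>s\<in>{a..<a + 2 ^ l}. ?F s x))"
      using that msg by (intro sum.cong) auto
    then show ?thesis by (simp add: sum.distrib sum.swap[of _ X])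
  qed
  have up: "b + 2 ^ Suc l = (b + 2 ^ l) + 2 ^ l" by simp
  have split: "(\<Sum>s\<in>{b..<b + 2 ^ Suc l}. ?T s)
      = (\<Sum>s\<in>{b..<b + 2 ^ l}. ?T s) + (\<Sum>s\<in>{b + 2 ^ l..<(b + 2 ^ l) + 2 ^ l}. ?T s)"
    unfolding up by (rule sum.atLeastLessThan_concat[symmetric]) auto
  have "spec X N B (select X K F (Suc l) b) (Suc 0 + (Suc 0 + 2 * l))
    (\<lambda>s. (\<Sum>s'\<in>{b..<b + 2 ^ Suc l}. ?T s') \<le> 2 ^ Suc l * ?T s)"
    unfolding select.simps up
  proof (rule spec_bind[OF spec_ask], rule less, assumption, rule spec_bind[OF spec_ask], rule less, assumption)
    fix f g
    assume f: "\<forall>x\<in>X. f x = nat (K + (\<Sum>s\<in>{b..<b + 2 ^ l}. ?F s x))"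
      and g: "\<forall>x\<in>X. g x = nat (K + (\<Sum>s\<in>{b + 2 ^ l..<(b + 2 ^ l) + 2 ^ l}. ?F s x))"
    let ?c = "if (\<Sum>x\<in>X. int (g x)) \<le> (\<Sum>x\<in>X. int (f x)) then b else b + 2 ^ l"
    have "(\<Sum>s'\<in>{b..<b + 2 ^ Suc l}. ?T s') \<le> 2 * (\<Sum>s'\<in>{?c..<?c + 2 ^ l}. ?T s')"
      unfolding split tot[OF f] tot[OF g] by auto
    then show "spec X N B (select X K F l ?c) (2 * l)
      (\<lambda>s. (\<Sum>s'\<in>{b..<b + 2 ^ l + 2 ^ l}. ?T s') \<le> 2 ^ Suc l * ?T s)"
      unfolding up by (intro spec_mono[OF Suc.IH[OF Kl]]) simp
  qed
  then show ?case by simp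
qed

text \<open>The last broadcast is there because only the node itself sees whether one of its
  neighbours has won; after it the new pair is public again.\<close>

definition phase_prog ::
  "nat set \<Rightarrow> int \<Rightarrow> (nat \<Rightarrow> nat \<Rightarrow> nat \<Rightarrow> bool) \<Rightarrow> nat \<Rightarrow> nat set \<times> nat set \<Rightarrow> (nat set \<times> nat set) prog" where
  "phase_prog X K mk L = (\<lambda>(U, I).
     bind (ask (\<lambda>x A. card (A \<inter> U))) (\<lambda>d.
     bind (ask (\<lambda>x A. if x \<in> U then cutoff U d x A else 0)) (\<lambda>t.
     bind (select X K (\<lambda>s x A. if x \<in> U then gain U d t {y \<in> U. mk s y (prio (d y))} x A else 0) L 0) (\<lambda>s.
     bind (ask (\<lambda>x A. of_bool (winner U d {y \<in> U. mk s y (prio (d y))} x A))) (\<lambda>w.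
     bind (ask (\<lambda>x A. of_bool (\<exists>y\<in>A. w y = 1))) (\<lambda>z.
     Ret ({x \<in> U. w x = 0 \<and> z x = 0}, I \<union> {x \<in> U. w x = 1})))))))"

primrec repeat_prog :: "nat \<Rightarrow> ('a \<Rightarrow> 'a prog) \<Rightarrow> 'a \<Rightarrow> 'a prog" where
  "repeat_prog 0 p a = Ret a"
| "repeat_prog (Suc i) p a = bind (p a) (repeat_prog i p)"

context nbr_graph
begin

text \<open>The undecided nodes \<open>U\<close> have no neighbour in \<open>I\<close>, and all
  other nodes are settled, so any solution on \<open>U\<close> completes \<open>I\<close>.\<close>

definition partial_mis :: "nat set \<Rightarrow> nat set \<Rightarrow> bool" where
  "partial_mis U I \<longleftrightarrow> U \<subseteq> X \<and> I \<subseteq> X - U \<and> (\<forall>x\<in>I \<union> U. N x \<inter> I = {}) \<and> (\<forall>x\<in>X - U - I. N x \<inter> I \<noteq> {})"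

definition arcs :: "nat set \<Rightarrow> nat" where
  "arcs U = (\<Sum>x\<in>U. card (N x \<inter> U))"

lemma partial_mis_step:
  assumes P: "partial_mis U I" and J: "J \<subseteq> U" "\<And>x. x \<in> J \<Longrightarrow> N x \<inter> J = {}"
  shows "partial_mis {x \<in> U. x \<notin> J \<and> N x \<inter> J = {}} (I \<union> J)"
proof -
  have sym: "y \<in> N x \<longleftrightarrow> x \<in> N y" if "x \<in> X" "y \<in> X" for x y using N_sym that by blast
  have sub: "U \<subseteq> X" "I \<subseteq> X" using P by (auto simp: partial_mis_def)
  have IJ: "N x \<inter> J = {}" if "x \<in> I" for x
  proof -
    have "x \<notin> N y" if "y \<in> J" for y using P J(1) \<open>x \<in> I\<close> that by (auto simp: partial_mis_def)
    then show ?thesis using sym sub J(1) \<open>x \<in> I\<close> by blast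
  qed
  show ?thesis using P J IJ unfolding partial_mis_def by blast
qed

lemma spec_phase_prog:
  assumes P: "partial_mis U I"
    and mk: "marking b m L mk"
    and m: "\<And>x. x \<in> X \<Longrightarrow> prio (card (N x)) \<le> m"
    and B: "card X + 1 < B" "X \<subseteq> {..<b}" "b < B"
    and K: "2 ^ L * (int (card X) + 2) ^ 4 \<le> K" "2 * K < int B"
  shows "spec X N B (phase_prog X K mk L (U, I)) (2 * L + 4)
    (\<lambda>(U', I'). partial_mis U' I' \<and> 256 * arcs U' \<le> 255 * arcs U)"
proof -
  have UX: "U \<subseteq> X" using P by (auto simp: partial_mis_def)
  have finN: "finite (N x)" if "x \<in> X" for x using that N_subset finite_X finite_subset by blast
  have card_le: "card S \<le> card X" if "S \<subseteq> X" for S using that finite_X card_mono by blast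
  have card_NU: "card (N x \<inter> U) \<le> card X" for x by (rule card_le) (use UX in blast)
  have "spec X N B (phase_prog X K mk L (U, I)) (Suc 0 + (Suc 0 + (2 * L + (Suc 0 + (Suc 0 + 0)))))
    (\<lambda>(U', I'). partial_mis U' I' \<and> 256 * arcs U' \<le> 255 * arcs U)"
    unfolding phase_prog_def prod.case
  proof (rule spec_bind[OF spec_ask])
    fix x assume "x \<in> X"
    show "card (N x \<inter> U) < B" using card_NU[of x] B(1) by linarith
  next
    fix d assume d: "\<forall>x\<in>X. d x = card (N x \<inter> U)"
    have dX: "d x \<le> card X" if "x \<in> X" for x using d that card_NU by simp
    have d_prio: "prio (d x) \<le> m" if "x \<in> U" for x
    proof -
      have "x \<in> X" using that UX by auto
      then have "prio (d x) \<le> prio (card (N x))"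
        using d finN by (auto intro!: prio_mono card_mono)
      then show ?thesis using m[OF \<open>x \<in> X\<close>] by linarith
    qed
    show "spec X N B (bind (ask (\<lambda>x A. if x \<in> U then cutoff U d x A else 0)) (\<lambda>t.
       bind (select X K (\<lambda>s x A. if x \<in> U then gain U d t {y \<in> U. mk s y (prio (d y))} x A else 0) L 0) (\<lambda>s.
       bind (ask (\<lambda>x A. of_bool (winner U d {y \<in> U. mk s y (prio (d y))} x A))) (\<lambda>w.
       bind (ask (\<lambda>x A. of_bool (\<exists>y\<in>A. w y = 1))) (\<lambda>z.
       Ret ({x \<in> U. w x = 0 \<and> z x = 0}, I \<union> {x \<in> U. w x = 1}))))))
      (Suc 0 + (2 * L + (Suc 0 + (Suc 0 + 0))))
      (\<lambda>(U', I'). partial_mis U' I' \<and> 256 * arcs U' \<le> 255 * arcs U)"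
    proof (rule spec_bind[OF spec_ask])
      fix x assume "x \<in> X"
      interpret phase X N U d "\<lambda>x. cutoff U d x (N x)"
        by unfold_locales (use UX d in auto)
      show "(if x \<in> U then cutoff U d x (N x) else 0) < B"
        using cutoff_props(3)[of x b, OF _ refl order_trans[OF UX B(2)]] B by auto
    next
      fix t assume t: "\<forall>x\<in>X. t x = (if x \<in> U then cutoff U d x (N x) else 0)"
      interpret marked_phase X N U d t mk b m L
        by unfold_locales (use UX d t mk B(2) d_prio in auto)
      let ?G = "(int (card X) + 2) ^ 4"
      \<comment> \<open>A rough bound of order \<open>n ^ 3\<close>; anything polynomial in
        \<open>n\<close> keeps the messages of \<open>select\<close> at \<open>O(log n)\<close>
        bits.\<close>
      have gain_le: "\<bar>gain U d t M x (N x)\<bar> \<le> ?G" if "x \<in> U" "M \<subseteq> U" for M x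
      proof -
        let ?n = "int (card X)" and ?y = "int (card (sh x \<inter> M))"
        let ?h = "int (card (hi x \<inter> M))" and ?s = "\<Sum>w | w \<in> hi x \<and> x < t w. int (d w)"
        have "lo x \<subseteq> X" "hi x \<subseteq> X" using UX by (auto simp: low_def high_def)
        then have "card (sh x \<inter> M) \<le> card X" "card (hi x \<inter> M) \<le> card X"
          "card {w. w \<in> hi x \<and> x < t w} \<le> card X"
          by (auto intro!: card_le)
        then have y: "?y \<le> ?n" and h: "?h \<le> ?n" and c: "int (card {w. w \<in> hi x \<and> x < t w}) \<le> ?n"
          by simp_all
        have "?s \<le> (\<Sum>w | w \<in> hi x \<and> x < t w. ?n)"
          by (intro sum_mono) (use dX \<open>hi x \<subseteq> X\<close> in auto)
        also have "\<dots> \<le> ?n * ?n" using c by (simp add: mult_right_mono)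
        finally have s: "?s \<le> ?n * ?n" .
        have s0: "0 \<le> ?s" by (intro sum_nonneg) auto
        have hs: "?h * ?s \<le> ?n * (?n * ?n)" using h s s0 by (intro mult_mono) auto
        have hs0: "0 \<le> ?h * ?s" using s0 by simp
        have dn: "int (d x) \<le> ?n" using dX that UX by auto
        have "(?y - 1) * (?y - 1) \<ge> 0" by simp
        then have y1: "?y - ?y * (?y - 1) \<le> 1" by (simp add: algebra_simps)
        have "?y * ?y \<le> ?n * ?n" using y by (intro mult_mono) auto
        then have y2: "?y - ?y * (?y - 1) \<ge> - (?n * ?n)" by (simp add: algebra_simps)
        have y3: "\<bar>?y - ?y * (?y - 1)\<bar> \<le> ?n * ?n + 1" 
        proof -
          have "0 \<le> ?n * ?n" by simp
          then show ?thesis using y1 y2 by linarith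
        qed
        have "\<bar>int (d x) * (?y - ?y * (?y - 1))\<bar> \<le> ?n * (?n * ?n + 1)"
          unfolding abs_mult using dn y3 by (intro mult_mono) auto
        moreover have "\<bar>if x \<in> M then ?h * ?s else 0\<bar> \<le> ?n * (?n * ?n)" using hs hs0 by simp
        ultimately have "\<bar>gain U d t M x (N x)\<bar> \<le> ?n * (?n * ?n + 1) + ?n * (?n * ?n)"
          unfolding gain_def Let_def by linarith
        also have "\<dots> \<le> ?G" by (simp add: power4_eq_xxxx algebra_simps)
        finally show ?thesis .
      qed
      show "spec X N B (
         bind (select X K (\<lambda>s x A. if x \<in> U then gain U d t {y \<in> U. mk s y (prio (d y))} x A else 0) L 0) (\<lambda>s.
         bind (ask (\<lambda>x A. of_bool (winner U d {y \<in> U. mk s y (prio (d y))} x A))) (\<lambda>w.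
         bind (ask (\<lambda>x A. of_bool (\<exists>y\<in>A. w y = 1))) (\<lambda>z.
         Ret ({x \<in> U. w x = 0 \<and> z x = 0}, I \<union> {x \<in> U. w x = 1})))))
        (2 * L + (Suc 0 + (Suc 0 + 0)))
        (\<lambda>(U', I'). partial_mis U' I' \<and> 256 * arcs U' \<le> 255 * arcs U)"
      proof (rule spec_bind[OF spec_select[where G = ?G]])
        fix s x assume "x \<in> X"
        show "\<bar>if x \<in> U then gain U d t {y \<in> U. mk s y (prio (d y))} x (N x) else 0\<bar> \<le> ?G"
          using gain_le[of x "{y \<in> U. mk s y (prio (d y))}"] by auto
      next
        fix s
        let ?g = "\<lambda>s x. if x \<in> U then gain U d t {y \<in> U. mk s y (prio (d y))} x (N x) else 0"
        assume s: "(\<Sum>s'\<in>{0..<0 + 2 ^ L}. \<Sum>x\<in>X. ?g s' x) \<le> 2 ^ L * (\<Sum>x\<in>X. ?g s x)"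
        let ?M = "{y \<in> U. mk s y (prio (d y))}"
        have g: "(\<Sum>x\<in>X. ?g s x) = (\<Sum>x\<in>U. gain U d t (marked s) x (N x))" for s
        proof -
          have "(\<Sum>x\<in>U. gain U d t (marked s) x (N x)) = (\<Sum>x\<in>X \<inter> U. gain U d t (marked s) x (N x))"
            using UX by (simp add: Int_absorb1)
          then show ?thesis unfolding marked_def by (simp add: sum.inter_restrict finite_X)
        qed
        have s': "(\<Sum>s'<2 ^ L. \<Sum>x\<in>U. gain U d t (marked s') x (N x))
            \<le> 2 ^ L * (\<Sum>x\<in>U. gain U d t (marked s) x (N x))"
          using s unfolding g by (simp add: atLeast0LessThan)
        let ?J = "{x \<in> X. winner U d ?M x (N x)}"
        have JU: "?J \<subseteq> U" by (auto simp: winner_def)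
        \<comment> \<open>Of two adjacent marked nodes, the one whose \<open>prio\<close> is not
          larger has the other in its \<open>high\<close> set and cannot win.\<close>
        have J_indep: "N x \<inter> ?J = {}" if x: "x \<in> ?J" for x
        proof (rule ccontr)
          assume "N x \<inter> ?J \<noteq> {}"
          then obtain y where y: "y \<in> N x" "y \<in> ?J" by auto
          then have "x \<in> N y" using x N_sym by auto
          then show False
            using x y JU by (cases "prio (d x) \<le> prio (d y)") (auto simp: winner_def high_def)
        qed
        show "spec X N B (
           bind (ask (\<lambda>x A. of_bool (winner U d ?M x A))) (\<lambda>w.
           bind (ask (\<lambda>x A. of_bool (\<exists>y\<in>A. w y = 1))) (\<lambda>z.
           Ret ({x \<in> U. w x = 0 \<and> z x = 0}, I \<union> {x \<in> U. w x = 1}))))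
          (Suc 0 + (Suc 0 + 0))
          (\<lambda>(U', I'). partial_mis U' I' \<and> 256 * arcs U' \<le> 255 * arcs U)"
        proof (rule spec_bind[OF spec_ask], use B in simp, rule spec_bind[OF spec_ask], use B in simp)
          fix w z
          assume w: "\<forall>x\<in>X. w x = of_bool (winner U d ?M x (N x))"
            and z: "\<forall>x\<in>X. z x = of_bool (\<exists>y\<in>N x. w y = 1)"
          have w1: "w x = 1 \<longleftrightarrow> x \<in> ?J" if "x \<in> X" for x using w that by simp
          have J: "{x \<in> U. w x = 1} = ?J" using w UX JU by auto
          have U': "{x \<in> U. w x = 0 \<and> z x = 0} = {x \<in> U. x \<notin> ?J \<and> N x \<inter> ?J = {}}" (is "_ = ?U'")
          proof -
            have "w x = 0 \<and> z x = 0 \<longleftrightarrow> x \<notin> ?J \<and> N x \<inter> ?J = {}" if "x \<in> U" for x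
            proof -
              have "x \<in> X" "N x \<subseteq> X" using that UX N_subset by auto
              then have "(\<exists>y\<in>N x. w y = 1) \<longleftrightarrow> N x \<inter> ?J \<noteq> {}" using w1 by blast
              then show ?thesis using w z \<open>x \<in> X\<close> by auto
            qed
            then show ?thesis by blast
          qed
          have "partial_mis ?U' (I \<union> ?J)" by (rule partial_mis_step[OF P JU J_indep])
          moreover have "256 * arcs ?U' \<le> 255 * arcs U"
            unfolding arcs_def
          proof (rule phase_progress[OF s'])
            show "?U' \<subseteq> {x \<in> U. \<forall>v\<in>N x. \<not> winner U d (marked s) v (N v)}"
              using UX N_subset unfolding marked_def by blast
          qed
          ultimately show "spec X N B (Ret ({x \<in> U. w x = 0 \<and> z x = 0}, I \<union> {x \<in> U. w x = 1})) 0
            (\<lambda>(U', I'). partial_mis U' I' \<and> 256 * arcs U' \<le> 255 * arcs U)"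
            unfolding J U' by (intro spec_Ret) simp
        qed
      qed (use K in auto)
    qed
  qed
  moreover have "Suc 0 + (Suc 0 + (2 * L + (Suc 0 + (Suc 0 + 0)))) = 2 * L + 4" by simp
  ultimately show ?thesis by (simp only:)
qed

end

section \<open>The complete algorithm\<close>

text \<open>Message 0 says that the list is exhausted; neighbours are shifted by \<open>Suc\<close>
  because 0 may be an identifier.\<close>

primrec collect :: "nat \<Rightarrow> (nat \<Rightarrow> nat set) prog" where
  "collect 0 = Ret (\<lambda>_. {})"
| "collect (Suc i) =
     bind (collect i) (\<lambda>f.
     bind (ask (\<lambda>x A. if i < card A then Suc (sorted_list_of_set A ! i) else 0)) (\<lambda>g.
     Ret (\<lambda>x. f x \<union> {y. g x = Suc y})))"

text \<open>The maximum degree is not part of a view; the second round makes it public. In the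
  second branch \<open>mk\<close> is chosen from public parameters alone, so all nodes agree on
  it.\<close>

definition mis_prog :: "nat \<Rightarrow> nat \<Rightarrow> nat set prog" where
  "mis_prog k n =
     bind nodes (\<lambda>X.
     bind (ask (\<lambda>x A. card A)) (\<lambda>d.
     let \<Delta> = Max (insert 0 (d ` X)) in
     if 2 ^ \<Delta> \<le> n + 2 then bind (collect \<Delta>) (\<lambda>f. Ret (SOME I. mis X f I))
     else
       let m = prio \<Delta>; r = (LEAST r. (k + 7) * \<Delta> \<le> 2 ^ r); L = 2 * m + r;
         mk = (SOME mk. marking ((n + 2) ^ k) m L mk)
       in bind (repeat_prog (512 * (LEAST j. n + 2 \<le> 2 ^ j))
              (phase_prog X (2 ^ L * (int n + 2) ^ 4) mk L) (X, {}))
            (\<lambda>(U, I). Ret (I \<union> U))))"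

lemma mis_cong: "(\<And>x. x \<in> X \<Longrightarrow> N x = N' x) \<Longrightarrow> mis X N I = mis X N' I"
  unfolding mis_def by (metis Diff_iff subsetD)

text \<open>Bernoulli gives \<open>(1 + 1 / x) ^ (x + 1) \<ge> 2\<close>, and squaring gives 4. For
  \<open>x = 255\<close> the exponent is 512: that many phases divide the number of arcs by at least
  4.\<close>

lemma four_times_power_le:
  fixes x :: nat
  assumes "0 < x"
  shows "4 * x ^ (2 * (x + 1)) \<le> (x + 1) ^ (2 * (x + 1))"
proof -
  have "1 + real (x + 1) * (1 / real x) \<le> (1 + 1 / real x) ^ (x + 1)"
    by (rule Bernoulli_inequality, rule order_trans[of _ 0]) simp_all
  moreover have "2 \<le> 1 + real (x + 1) * (1 / real x)" using assms by (simp add: field_simps)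
  ultimately have "2 \<le> (1 + 1 / real x) ^ (x + 1)" by linarith
  then have "2 * real x ^ (x + 1) \<le> (1 + 1 / real x) ^ (x + 1) * real x ^ (x + 1)"
    by (rule mult_right_mono) simp
  also have "\<dots> = (real x + 1) ^ (x + 1)"
    using assms by (simp add: field_simps flip: power_mult_distrib)
  finally have "real (2 * x ^ (x + 1)) \<le> real ((x + 1) ^ (x + 1))"
    by (simp only: of_nat_mult of_nat_power of_nat_add of_nat_numeral of_nat_1)
  then have "2 * x ^ (x + 1) \<le> (x + 1) ^ (x + 1)" by (simp only: of_nat_le_iff)
  then have "(2 * x ^ (x + 1)) ^ 2 \<le> ((x + 1) ^ (x + 1)) ^ 2" by (rule power_mono) simp
  then show ?thesis by (simp only: power_mult_distrib power_even_eq) simp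
qed

lemma contraction_power_le: "255 ^ (512 * j) * 4 ^ j \<le> (256 ^ (512 * j) :: nat)"
proof -
  have e: "255 + 1 = (256 :: nat)" "2 * 256 = (512 :: nat)" by simp_all
  have "255 ^ 512 * 4 \<le> (256 ^ 512 :: nat)"
    unfolding mult.commute[of _ 4]
    using four_times_power_le[of 255] unfolding e by (simp only: zero_less_numeral simp_thms)
  then show ?thesis
    unfolding power_mult power_mult_distrib[symmetric] by (rule power_mono) (rule zero_le)
qed

section \<open>Correctness and cost of the algorithm\<close>

context nbr_graph
begin

lemma finite_nbrs: "x \<in> X \<Longrightarrow> finite (N x)"
  using N_subset finite_X finite_subset by blast

lemma spec_repeat_prog:
  assumes "\<And>U I. partial_mis U I \<Longrightarrow> spec X N B (p (U, I)) T
      (\<lambda>(U', I'). partial_mis U' I' \<and> 256 * arcs U' \<le> 255 * arcs U)"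
    and "partial_mis U I"
  shows "spec X N B (repeat_prog i p (U, I)) (i * T)
      (\<lambda>(U', I'). partial_mis U' I' \<and> 256 ^ i * arcs U' \<le> 255 ^ i * arcs U)"
  using assms(2)
proof (induction i arbitrary: U I)
  case 0
  then show ?case by (auto intro!: spec_Ret)
next
  case (Suc i)
  have "spec X N B (bind (p (U, I)) (repeat_prog i p)) (T + i * T)
      (\<lambda>(U', I'). partial_mis U' I' \<and> 256 ^ Suc i * arcs U' \<le> 255 ^ Suc i * arcs U)"
  proof (rule spec_bind[OF assms(1)[OF Suc.prems]])
    fix a assume "case a of (U', I') \<Rightarrow> partial_mis U' I' \<and> 256 * arcs U' \<le> 255 * arcs U"
    then obtain U' I' where a: "a = (U', I')" "partial_mis U' I'" "256 * arcs U' \<le> 255 * arcs U" by auto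
    show "spec X N B (repeat_prog i p a) (i * T)
      (\<lambda>(U', I'). partial_mis U' I' \<and> 256 ^ Suc i * arcs U' \<le> 255 ^ Suc i * arcs U)"
      unfolding a(1)
    proof (rule spec_mono[OF Suc.IH[OF a(2)]], clarify)
      fix U'' assume "256 ^ i * arcs U'' \<le> 255 ^ i * arcs U'"
      then have "256 * (256 ^ i * arcs U'') \<le> 255 ^ i * (256 * arcs U')" by simp
      also have "\<dots> \<le> 255 ^ i * (255 * arcs U)" using a(3) by (rule mult_le_mono2)
      finally show "256 ^ Suc i * arcs U'' \<le> 255 ^ Suc i * arcs U"
        by (simp only: power_Suc mult_ac)
    qed
  qed
  then show ?case by simp
qed

text \<open>There are fewer than \<open>4 ^ j\<close> arcs initially, and \<open>512 * j\<close>
  phases divide their number by at least \<open>4 ^ j\<close>; a natural number below 1 is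
  0.\<close>

lemma arcs_eq_0:
  assumes "256 ^ (512 * j) * arcs U \<le> 255 ^ (512 * j) * arcs X" "card X \<le> 2 ^ j"
  shows "arcs U = 0"
proof (rule ccontr)
  assume "arcs U \<noteq> 0"
  have "arcs X \<le> (\<Sum>x\<in>X. card X - 1)"
    unfolding arcs_def
  proof (rule sum_mono)
    fix x assume x: "x \<in> X"
    then have "card (N x \<inter> X) \<le> card (X - {x})"
      using N_irrefl finite_X by (intro card_mono) auto
    then show "card (N x \<inter> X) \<le> card X - 1" using x finite_X by simp
  qed
  also have "\<dots> = card X * (card X - 1)" by simp
  finally have 1: "arcs X \<le> card X * (card X - 1)" .
  have "0 < arcs X"
  proof (rule ccontr)
    assume "\<not> 0 < arcs X"
    then have "256 ^ (512 * j) * arcs U = 0" using assms(1) by simp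
    then show False using \<open>arcs U \<noteq> 0\<close> by simp
  qed
  then have "0 < card X" using 1 by (cases "card X") auto
  then have "card X * (card X - 1) < card X * card X" by simp
  also have "\<dots> \<le> 2 ^ j * 2 ^ j" using assms(2) by (intro mult_le_mono)
  finally have "arcs X < 2 ^ j * 2 ^ j" using 1 by linarith
  then have X4: "arcs X < 4 ^ j" by (simp flip: power_mult_distrib)
  have "256 ^ (512 * j) * 1 \<le> 256 ^ (512 * j) * arcs U"
    using \<open>arcs U \<noteq> 0\<close> by (intro mult_le_mono2) simp
  also have "\<dots> \<le> 255 ^ (512 * j) * arcs X" by (rule assms(1))
  also have "\<dots> < 255 ^ (512 * j) * 4 ^ j" using X4 by (intro mult_strict_left_mono) auto
  also have "\<dots> \<le> 256 ^ (512 * j)" by (rule contraction_power_le)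
  finally show False by simp
qed

text \<open>Without arcs the undecided nodes are independent and can join all at once.\<close>

lemma mis_of_partial_mis:
  assumes "partial_mis U I" "arcs U = 0"
  shows "mis X N (I \<union> U)"
proof -
  have UX: "U \<subseteq> X" using assms(1) by (auto simp: partial_mis_def)
  have U: "N x \<inter> U = {}" if "x \<in> U" for x
    using assms(2) that UX finite_X finite_nbrs finite_subset[of U X] unfolding arcs_def by auto
  have "N x \<inter> U = {}" if "x \<in> I" for x
  proof -
    have "x \<in> X" using assms(1) that by (auto simp: partial_mis_def)
    have "x \<notin> N y" if "y \<in> U" for y using assms(1) \<open>x \<in> I\<close> that by (auto simp: partial_mis_def)
    then show ?thesis using N_sym[OF \<open>x \<in> X\<close>] by blast
  qed
  then show ?thesis using assms(1) U unfolding mis_def partial_mis_def by blast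
qed

lemma spec_collect:
  assumes "X \<subseteq> {..<b}" "b < B"
  shows "spec X N B (collect i) i (\<lambda>f. \<forall>x\<in>X. f x = set (take i (sorted_list_of_set (N x))))"
proof (induction i)
  case 0
  show ?case by (auto intro!: spec_Ret)
next
  case (Suc i)
  have "spec X N B (collect (Suc i)) (i + (Suc 0 + 0))
     (\<lambda>f. \<forall>x\<in>X. f x = set (take (Suc i) (sorted_list_of_set (N x))))"
    unfolding collect.simps
  proof (rule spec_bind[OF Suc.IH], rule spec_bind[OF spec_ask])
    fix x assume x: "x \<in> X"
    show "(if i < card (N x) then Suc (sorted_list_of_set (N x) ! i) else 0) < B"
    proof (cases "i < card (N x)")
      case True
      then have "sorted_list_of_set (N x) ! i \<in> N x"
        using finite_nbrs[OF x] nth_mem[of i "sorted_list_of_set (N x)"] by simp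
      then have "sorted_list_of_set (N x) ! i < b" using assms(1) N_subset[OF x] by auto
      then show ?thesis using assms(2) by simp
    qed (use assms in simp)
  next
    fix f g
    assume f: "\<forall>x\<in>X. f x = set (take i (sorted_list_of_set (N x)))"
      and g: "\<forall>x\<in>X. g x = (if i < card (N x) then Suc (sorted_list_of_set (N x) ! i) else 0)"
    show "spec X N B (Ret (\<lambda>x. f x \<union> {y. g x = Suc y})) 0
      (\<lambda>f. \<forall>x\<in>X. f x = set (take (Suc i) (sorted_list_of_set (N x))))"
    proof (rule spec_Ret, rule ballI)
      fix x assume x: "x \<in> X"
      show "f x \<union> {y. g x = Suc y} = set (take (Suc i) (sorted_list_of_set (N x)))"
        using f g x by (cases "i < card (N x)") (auto simp: take_Suc_conv_app_nth)
    qed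
  qed
  then show ?case by simp
qed

lemma spec_mis_prog:
  assumes n: "card X = n" and X: "X \<subseteq> {..<(n + 2) ^ k}"
  defines "\<Delta> \<equiv> Max (insert 0 ((\<lambda>x. card (N x)) ` X))"
  shows "\<exists>T. spec X N ((n + 2) ^ (k + 30)) (mis_prog k n) T (mis X N) \<and>
    (2 ^ \<Delta> \<le> n + 2 \<and> T = \<Delta> + 2 \<or>
     (\<exists>j L. 0 < \<Delta> \<and> T = 2 + 512 * j * (2 * L + 4) \<and> 2 ^ j \<le> 2 * (n + 2) \<and> 2 ^ L \<le> 2 ^ 13 * (k + 7) * \<Delta> ^ 3))"
proof -
  let ?q = "n + 2" and ?B = "(n + 2) ^ (k + 30)"
  have B: "?q ^ i \<le> ?B" if "i \<le> k + 30" for i using that by (intro power_increasing) auto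
  have kB: "?q ^ k < ?B" by (intro power_strict_increasing) auto
  have qB: "?q \<le> ?B" using B[of 1] by simp
  have B0: "0 < ?B" by simp
  have card_N: "card (N x) \<le> \<Delta>" if "x \<in> X" for x
    unfolding \<Delta>_def using that finite_X by (intro Max_ge) auto
  have card_Nn: "card (N x) \<le> n" if "x \<in> X" for x
    using that N_subset finite_X n card_mono by blast
  have \<Delta>n: "\<Delta> \<le> n"
    unfolding \<Delta>_def using finite_X card_Nn by (subst Max_le_iff) auto
  define m where "m = prio \<Delta>"
  define r where "r = (LEAST r. (k + 7) * \<Delta> \<le> 2 ^ r)"
  define L where "L = 2 * m + r"
  define j where "j = (LEAST j. ?q \<le> 2 ^ j)"
  define mk where "mk = (SOME mk. marking (?q ^ k) m L mk)"
  let ?p = "if 2 ^ \<Delta> \<le> ?q then bind (collect \<Delta>) (\<lambda>f. Ret (SOME I. mis X f I))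
     else bind (repeat_prog (512 * j) (phase_prog X (2 ^ L * (int n + 2) ^ 4) mk L) (X, {}))
            (\<lambda>(U, I). Ret (I \<union> U))"
  have start: "spec X N ?B (mis_prog k n) (Suc 0 + (Suc 0 + T)) (mis X N)"
    if "spec X N ?B ?p T (mis X N)" for T
    unfolding mis_prog_def
  proof (rule spec_bind[OF spec_nodes[OF B0]], hypsubst, rule spec_bind[OF spec_ask])
    fix x assume "x \<in> X"
    then show "card (N x) < ?B" using card_Nn[of x] qB by simp
  next
    fix d assume "\<forall>x\<in>X. d x = card (N x)"
    then have "d ` X = (\<lambda>x. card (N x)) ` X" by (intro image_cong) auto
    then have \<Delta>: "Max (insert 0 (d ` X)) = \<Delta>" by (simp add: \<Delta>_def)
    show "spec X N ?B (let \<Delta> = Max (insert 0 (d ` X)) in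
       if 2 ^ \<Delta> \<le> n + 2 then bind (collect \<Delta>) (\<lambda>f. Ret (SOME I. mis X f I))
       else
         let m = prio \<Delta>; r = (LEAST r. (k + 7) * \<Delta> \<le> 2 ^ r); L = 2 * m + r;
           mk = (SOME mk. marking ((n + 2) ^ k) m L mk)
         in bind (repeat_prog (512 * (LEAST j. n + 2 \<le> 2 ^ j))
                (phase_prog X (2 ^ L * (int n + 2) ^ 4) mk L) (X, {}))
              (\<lambda>(U, I). Ret (I \<union> U))) T (mis X N)"
      unfolding Let_def \<Delta> using that unfolding mk_def j_def L_def m_def r_def .
  qed
  show ?thesis
  proof (cases "2 ^ \<Delta> \<le> ?q")
    case True
    have "spec X N ?B (bind (collect \<Delta>) (\<lambda>f. Ret (SOME I. mis X f I))) (\<Delta> + 0) (mis X N)"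
    proof (rule spec_bind[OF spec_collect[OF X kB]], rule spec_Ret)
      fix f assume f: "\<forall>x\<in>X. f x = set (take \<Delta> (sorted_list_of_set (N x)))"
      have "f x = N x" if "x \<in> X" for x
        using f that card_N[OF that] finite_nbrs[OF that] by simp
      then have "mis X f = mis X N" using mis_cong[of X f N] by blast
      then show "mis X N (SOME I. mis X f I)" using mis_exists by (simp add: someI_ex)
    qed
    then have "spec X N ?B (mis_prog k n) (Suc 0 + (Suc 0 + \<Delta>)) (mis X N)"
      using True by (intro start) simp
    then show ?thesis using True by (intro exI[of _ "\<Delta> + 2"]) simp
  next
    case False
    then have big: "?q < 2 ^ \<Delta>" by simp
    then have \<Delta>0: "0 < \<Delta>" by (cases \<Delta>) auto
    have r: "(k + 7) * \<Delta> \<le> 2 ^ r" "2 ^ r < 2 * ((k + 7) * \<Delta>)"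
      unfolding r_def using Least_power_ge[of "(k + 7) * \<Delta>"] \<Delta>0 by auto
    have j: "?q \<le> 2 ^ j" "2 ^ j < 2 * ?q" unfolding j_def using Least_power_ge[of ?q] by auto
    have m: "2 ^ m < 64 * \<Delta>" unfolding m_def by (rule prio_less[OF \<Delta>0])
    have two_q: "2 ^ i \<le> ?q ^ i" for i :: nat by (intro power_mono) auto
    have "2 ^ L = 2 ^ m * 2 ^ m * (2 ^ r :: nat)" by (simp add: L_def power_add mult_2)
    also have "\<dots> \<le> (64 * \<Delta>) * (64 * \<Delta>) * (2 * ((k + 7) * \<Delta>))"
      using m r(2) by (intro mult_le_mono) auto
    also have "\<dots> = 2 ^ 13 * (k + 7) * \<Delta> ^ 3" by (simp add: power3_eq_cube algebra_simps)
    finally have L: "2 ^ L \<le> 2 ^ 13 * (k + 7) * \<Delta> ^ 3" .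
    \<comment> \<open>Exponents 13, \<open>k + 7\<close> and 3 add up to \<open>k + 23\<close>. The
      shift \<open>K\<close> contributes 4 more and its factor 2 another one, which stays below
      \<open>k + 30\<close>.\<close>
    also have "\<dots> \<le> ?q ^ 13 * ?q ^ (k + 7) * ?q ^ 3"
      using \<Delta>n two_q[of "k + 7"] less_exp[of "k + 7"] two_q[of 13] by (intro mult_le_mono power_mono) auto
    also have "\<dots> = ?q ^ (k + 23)" by (simp only: flip: power_add) (simp add: add.commute)
    finally have Lq: "2 ^ L \<le> ?q ^ (k + 23)" .
    have "?q ^ k * (m + 1) < ?q ^ k * ?q ^ 7"
    proof -
      have "m + 1 \<le> 2 ^ m" using less_exp[of m] by linarith
      also have "\<dots> < 64 * \<Delta>" by (rule m)
      also have "\<dots> \<le> ?q ^ 6 * ?q" using two_q[of 6] \<Delta>n by (intro mult_le_mono) auto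
      also have "\<dots> = ?q ^ 7" by (simp only: power_Suc2[symmetric]) simp
      finally show ?thesis by (intro mult_strict_left_mono) auto
    qed
    also have "\<dots> = ?q ^ (k + 7)" by (simp only: power_add)
    \<comment> \<open>Here the case assumption pays off: identifiers times levels stay below
      \<open>2 ^ ((k + 7) * \<Delta>)\<close>, so an \<open>r\<close> of order
      \<open>log \<Delta>\<close> suffices for fixed \<open>k\<close>.\<close>
    also have "\<dots> \<le> (2 ^ \<Delta>) ^ (k + 7)" using big by (intro power_mono) auto
    also have "\<dots> = 2 ^ ((k + 7) * \<Delta>)" by (simp only: mult.commute flip: power_mult)
    also have "\<dots> \<le> 2 ^ (2 ^ r)" using r(1) by (intro power_increasing) auto
    also have "\<dots> \<le> 4 ^ (2 ^ r)" by (intro power_mono) auto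
    finally have "\<exists>mk. marking (?q ^ k) m L mk" unfolding L_def by (rule marking_exists)
    then have mk: "marking (?q ^ k) m L mk" unfolding mk_def by (rule someI_ex)
    have "2 * (2 ^ L * ?q ^ 4) < ?B"
    proof -
      have "2 * (2 ^ L * ?q ^ 4) \<le> ?q * (?q ^ (k + 23) * ?q ^ 4)"
        using Lq by (intro mult_le_mono) auto
      also have "\<dots> = ?q ^ (k + 28)" by (simp only: flip: power_add power_Suc) simp
      also have "\<dots> < ?B" by (intro power_strict_increasing) auto
      finally show ?thesis .
    qed
    then have "int (2 * (2 ^ L * ?q ^ 4)) < int ?B" by (simp only: of_nat_less_iff)
    then have K: "2 * (2 ^ L * (int n + 2) ^ 4) < int ?B" by (simp add: add.commute)
    have "spec X N ?B (bind (repeat_prog (512 * j) (phase_prog X (2 ^ L * (int n + 2) ^ 4) mk L) (X, {}))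
            (\<lambda>(U, I). Ret (I \<union> U))) (512 * j * (2 * L + 4) + 0) (mis X N)"
    proof (rule spec_bind[OF spec_repeat_prog])
      fix U I assume "partial_mis U I"
      then show "spec X N ?B (phase_prog X (2 ^ L * (int n + 2) ^ 4) mk L (U, I)) (2 * L + 4)
        (\<lambda>(U', I'). partial_mis U' I' \<and> 256 * arcs U' \<le> 255 * arcs U)"
      proof (rule spec_phase_prog[OF _ mk])
        show "prio (card (N x)) \<le> m" if "x \<in> X" for x
          unfolding m_def using card_N[OF that] by (rule prio_mono)
      qed (use X kB qB K n in auto)
    next
      show "partial_mis X {}" by (simp add: partial_mis_def)
    next
      fix a assume "case a of (U', I') \<Rightarrow> partial_mis U' I' \<and> 256 ^ (512 * j) * arcs U' \<le> 255 ^ (512 * j) * arcs X"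
      then obtain U I where a: "a = (U, I)" "partial_mis U I" "256 ^ (512 * j) * arcs U \<le> 255 ^ (512 * j) * arcs X"
        by auto
      have "arcs U = 0" by (rule arcs_eq_0[OF a(3)]) (use j n in simp)
      then show "spec X N ?B (case a of (U, I) \<Rightarrow> Ret (I \<union> U)) 0 (mis X N)"
        unfolding a(1) prod.case by (intro spec_Ret mis_of_partial_mis a(2))
    qed
    then have "spec X N ?B (mis_prog k n) (Suc 0 + (Suc 0 + 512 * j * (2 * L + 4))) (mis X N)"
      using False by (intro start) simp
    then show ?thesis
      using \<Delta>0 j(2) L by (intro exI[of _ "2 + 512 * j * (2 * L + 4)"] conjI disjI2 exI[of _ j] exI[of _ L]) auto
  qed
qed

end

text \<open>The summand 2 inside the logarithms makes both at least 1, so additive constants are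
  absorbed. 1024 is \<open>512 * 2\<close> from \<open>j \<le> 1 + b \<le> 2 * b\<close>, and 50 is
  \<open>2 * 20 + 6 + 4\<close> from \<open>L \<le> k + 20 + 3 * a\<close>.\<close>

lemma round_bound:
  fixes n \<Delta> k T :: nat
  assumes "2 ^ \<Delta> \<le> n + 2 \<and> T = \<Delta> + 2 \<or>
     (\<exists>j L. 0 < \<Delta> \<and> T = 2 + 512 * j * (2 * L + 4) \<and> 2 ^ j \<le> 2 * (n + 2) \<and> 2 ^ L \<le> 2 ^ 13 * (k + 7) * \<Delta> ^ 3)"
  shows "real T \<le> (1024 * (2 * real k + 50) + 2) * log 2 (real \<Delta> + 2) * log 2 (real n + 2)"
proof -
  define a where "a = log 2 (real \<Delta> + 2)"
  define b where "b = log 2 (real n + 2)"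
  have a1: "1 \<le> a" and b1: "1 \<le> b" by (auto simp: a_def b_def le_log_iff)
  have ab: "b \<le> a * b" "1 \<le> a * b" using mult_mono[of 1 a 1 b] mult_right_mono[of 1 a b] a1 b1 by auto
  from assms have "real T \<le> (1024 * (2 * real k + 50) + 2) * (a * b)"
  proof (elim disjE conjE exE)
    assume "2 ^ \<Delta> \<le> n + 2" and T: "T = \<Delta> + 2"
    then have "real (2 ^ \<Delta>) \<le> real (n + 2)" by (rule_tac of_nat_mono)
    then have "real \<Delta> \<le> b" unfolding b_def by (subst le_log_iff) (auto simp: powr_realpow)
    then have "real T \<le> 3 * (a * b)" using T ab by simp
    also have "\<dots> \<le> (1024 * (2 * real k + 50) + 2) * (a * b)" using ab by (intro mult_right_mono) auto
    finally show ?thesis .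
  next
    fix j L assume \<Delta>: "0 < \<Delta>" and T: "T = 2 + 512 * j * (2 * L + 4)" and "2 ^ j \<le> 2 * (n + 2)"
      and "2 ^ L \<le> 2 ^ 13 * (k + 7) * \<Delta> ^ 3"
    then have "real (2 ^ j) \<le> real (2 * (n + 2))" "real (2 ^ L) \<le> real (2 ^ 13 * (k + 7) * \<Delta> ^ 3)"
      by (simp_all only: of_nat_le_iff)
    then have j: "2 ^ j \<le> 2 * (real n + 2)" and L: "2 ^ L \<le> 2 ^ 13 * (real k + 7) * real \<Delta> ^ 3"
      by simp_all
    have "real j \<le> log 2 (2 * (real n + 2))" using j by (subst le_log_iff) (auto simp: powr_realpow)
    also have "\<dots> = 1 + b" by (subst log_mult) (auto simp: b_def)
    finally have jb: "real j \<le> 2 * b" using b1 by linarith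
    have "k + 7 \<le> 2 ^ (k + 7)" using less_exp[of "k + 7"] by simp
    then have "real (k + 7) \<le> real (2 ^ (k + 7))" by (simp only: of_nat_le_iff)
    then have "2 ^ 13 * (real k + 7) * real \<Delta> ^ 3 \<le> 2 ^ 13 * 2 ^ (k + 7) * (real \<Delta> + 2) ^ 3"
      by (intro mult_mono power_mono) auto
    then have "2 ^ L \<le> 2 ^ (k + 20) * (real \<Delta> + 2) ^ 3"
      using L by (simp add: power_add)
    then have "real L \<le> log 2 (2 ^ (k + 20) * (real \<Delta> + 2) ^ 3)"
      by (subst le_log_iff) (auto simp: powr_realpow)
    also have "\<dots> = real (k + 20) + 3 * a" by (simp add: log_mult log_nat_power a_def)
    finally have "real L \<le> real (k + 20) + 3 * a" .
    moreover have "real (k + 20) * 1 \<le> real (k + 20) * a" using a1 by (intro mult_left_mono) auto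
    ultimately have La: "2 * real L + 4 \<le> (2 * real k + 50) * a"
      using a1 by (simp add: algebra_simps)
    have "real T = 2 + 512 * (real j * (2 * real L + 4))" by (simp add: T)
    also have "\<dots> \<le> 2 + 512 * ((2 * b) * ((2 * real k + 50) * a))"
      using jb La b1 by (intro add_left_mono mult_left_mono mult_mono) auto
    also have "\<dots> = 2 + 1024 * (2 * real k + 50) * (a * b)" by simp
    also have "\<dots> \<le> (1024 * (2 * real k + 50) + 2) * (a * b)"
      using ab by (simp add: algebra_simps)
    finally show ?thesis .
  qed
  then show ?thesis unfolding a_def b_def by (simp only: mult.assoc)
qed

theorem theorem2:
  shows "\<forall>k::nat. \<exists>(msg :: view \<Rightarrow> nat) (out :: view \<Rightarrow> bool option) (c::nat) (C::real).
     \<forall>n E (idf :: nat \<Rightarrow> nat).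
       simple_graph n E \<longrightarrow> inj_on idf {..<n} \<longrightarrow> (\<forall>v<n. idf v < (n + 2) ^ k) \<longrightarrow>
       (\<exists>T::nat. real T \<le> C * log 2 (real (max_degree n E) + 2) * log 2 (real n + 2) \<and>
                 computes_MIS_within msg out c T n E idf)"
proof
  fix k :: nat
  have "\<exists>T. real T \<le> (1024 * (2 * real k + 50) + 2) * log 2 (real (max_degree n E) + 2) * log 2 (real n + 2) \<and>
      computes_MIS_within (msg_of (mis_prog k)) (out_of (mis_prog k)) (k + 30) T n E idf"
    if E: "simple_graph n E" and inj: "inj_on idf {..<n}" and idf: "\<forall>v<n. idf v < (n + 2) ^ k"
    for n E and idf :: "nat \<Rightarrow> nat"
  proof -
    let ?X = "idf ` {..<n}" and ?N = "id_nbrs n E idf"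
    interpret nbr_graph ?X ?N by (rule nbr_graph_id_nbrs(1)[OF inj E])
    have "card ?X = n" using inj by (simp add: card_image)
    moreover have "?X \<subseteq> {..<(n + 2) ^ k}" using idf by auto
    moreover have "Max (insert 0 ((\<lambda>x. card (?N x)) ` ?X)) = max_degree n E"
    proof -
      have "(\<lambda>x. card (?N x)) ` ?X = {degree n E v | v. v < n}"
        using nbr_graph_id_nbrs(2)[OF inj E] by (force simp: image_image)
      then show ?thesis by (simp add: max_degree_def)
    qed
    ultimately show ?thesis
      using spec_mis_prog[of n k] round_bound[of "max_degree n E" n _ k]
        computes_MIS_within_prog[OF inj, of E "k + 30" "mis_prog k"]
      by metis
  qed
  then show "\<exists>(msg :: view \<Rightarrow> nat) (out :: view \<Rightarrow> bool option) (c::nat) (C::real).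
     \<forall>n E (idf :: nat \<Rightarrow> nat).
       simple_graph n E \<longrightarrow> inj_on idf {..<n} \<longrightarrow> (\<forall>v<n. idf v < (n + 2) ^ k) \<longrightarrow>
       (\<exists>T::nat. real T \<le> C * log 2 (real (max_degree n E) + 2) * log 2 (real n + 2) \<and>
                 computes_MIS_within msg out c T n E idf)"
    by blast
qed

end
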